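(* Let $m\ge 1$ and let $\mathfrak{I}^{(m)}$ be the set of all involutions (of all lengths $n\ge 0$) having no descending subsequence of length $m+1$. Then, as formal power series in $t$, $$\sum_{\tau\in\mathfrak{I}^{(m)}}\frac{t^{|\tau|}}{|\tau|!}=\begin{cases} e^t\,\det\left(I_{i-j}-I_{i+j}\right)_{1\le i,j\le\ell}, & \text{if } m=2\ell+1;\\[1mm] \det\left(I_{i-j}+I_{i+j-1}\right)_{1\le i,j\le\ell}, & \text{if } m=2\ell,\end{cases}$$ where for $i\in\mathbb{Z}$ $$I_i=\sum_{n\ge\max(0,-i)}\frac{t^{2n+i}}{n!\,(n+i)!}.$$
   Context: An involution of length $n$ is a permutation $\tau$ of $\{1,\dots,n\}$ with $\tau\circ\tau=\mathrm{id}$; $|\tau|=n$ is its length, and the empty permutation (length $0$) is included. A descending subsequence of $\tau$ of length $k$ is a $k$-tuple $(\tau(i_1),\dots,\tau(i_k))$ with $i_1<\cdots<i_k$ and $\tau(i_1)>\cdots>\tau(i_k)$. An empty determinant equals $1$. *)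

theory Defs
  imports
    "HOL-Combinatorics.Permutations"
    "HOL-Computational_Algebra.Formal_Power_Series"
    "HOL-Analysis.Infinite_Sum"
    "Jordan_Normal_Form.Determinant"
begin

(* An involution is the pair of its length n and its underlying function: a HOL function
   that permutes {1..n} is the identity elsewhere, so it does not determine n by itself. *)
definition involutions :: "(nat \<times> (nat \<Rightarrow> nat)) set" where
  "involutions = {(n, \<tau>). \<tau> permutes {1..n} \<and> \<tau> \<circ> \<tau> = id}"

definition has_descending_subsequence :: "nat \<Rightarrow> nat \<times> (nat \<Rightarrow> nat) \<Rightarrow> bool" where
  "has_descending_subsequence k = (\<lambda>(n, \<tau>).
     \<exists>is. length is = k \<and> set is \<subseteq> {1..n} \<and>
          sorted_wrt (<) is \<and> sorted_wrt (>) (map \<tau> is))"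

definition involutions_avoiding :: "nat \<Rightarrow> (nat \<times> (nat \<Rightarrow> nat)) set" where
  "involutions_avoiding m =
     {\<tau> \<in> involutions. \<not> has_descending_subsequence (m + 1) \<tau>}"

(* Infinite sums of formal power series are taken in the X-adic metric of the library,
   i.e. with coefficientwise eventually constant partial sums (see tendsto_fps_iff). *)
definition bessel_fps :: "int \<Rightarrow> rat fps" where
  "bessel_fps i =
     (\<Sum>\<^sub>\<infinity>n\<in>{n. int n \<ge> max 0 (- i)}.
        fps_const (1 / (fact n * fact (nat (int n + i)))) * fps_X ^ nat (2 * int n + i))"

(* The sum defining bessel_fps converges, so that infsum does not take its default value 0. *)
lemma bessel_fps_has_sum:
  "((\<lambda>n. fps_const (1 / (fact n * fact (nat (int n + i)))) * fps_X ^ nat (2 * int n + i))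
     has_sum bessel_fps i) {n. int n \<ge> max 0 (- i)}"
proof -
  let ?A = "{n. int n \<ge> max 0 (- i)}"
  let ?f = "\<lambda>n. fps_const (1 / (fact n * fact (nat (int n + i)))) *
                 fps_X ^ nat (2 * int n + i) :: rat fps"
  define F where "F = (\<lambda>k. {n \<in> ?A. nat (2 * int n + i) = k})"
  define S where "S = Abs_fps (\<lambda>k. \<Sum>n\<in>F k. fps_nth (?f n) k)"
  have fin: "finite (F k)" for k
    by (rule finite_subset[of _ "{..nat (int k + \<bar>i\<bar>)}"]) (auto simp: F_def)
  have "(?f has_sum S) ?A"
    unfolding has_sum_def
  proof (rule tendsto_fpsI)
    fix k
    have "fps_nth (sum ?f X) k = fps_nth S k"
      if X: "finite X" "F k \<subseteq> X" "X \<subseteq> ?A" for X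
      unfolding S_def fps_nth_Abs_fps fps_sum_nth
      by (rule sum.mono_neutral_right) (use X in \<open>auto simp: F_def fps_X_power_nth\<close>)
    then show "\<forall>\<^sub>F X in finite_subsets_at_top ?A. fps_nth (sum ?f X) k = fps_nth S k"
      unfolding eventually_finite_subsets_at_top
      by (intro exI[of _ "F k"]) (use fin in \<open>auto simp: F_def\<close>)
  qed
  then have "?f summable_on ?A"
    by (rule has_sum_imp_summable)
  then show ?thesis
    unfolding bessel_fps_def by (rule has_sum_infsum)
qed

end

theory Submission
  imports Defs
begin

text \<open>
  Read an involution as a partial matching with arcs \<open>i < \<tau> i\<close>. It has a descending subsequence
  of length \<open>2 l + 2\<close> iff \<open>l + 1\<close> arcs are nested, and one of length \<open>2 l + 1\<close> iff
  \<open>l + 1\<close> arcs are nested or \<open>l\<close> nested arcs surround a fixed point.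
  Fomin's growth diagram on the triangle \<open>a \<le> b\<close> turns involutions of length \<open>n\<close> into closed
  walks of \<open>n\<close> steps in Young's lattice starting at the empty shape: an opener adds a box, a closer
  removes one, a fixed point stays. The local rules are invertible, so this is a bijection, and the
  number of columns of a shape is the largest nesting it has seen. Hence avoidance confines the walk
  to shapes with at most \<open>l\<close> columns, where for even \<open>m\<close> staying requires fewer than \<open>l\<close>.

  As \<open>I\<^sub>i' = I\<^sub>i\<^sub>-\<^sub>1 + I\<^sub>i\<^sub>+\<^sub>1\<close>, differentiating a determinant whose rows are indexed by the positions of
  \<open>l\<close> walkers sums over all moves of one walker. The determinant vanishes when two walkers collide,
  and at the wall it vanishes (odd \<open>m\<close>) or reflects into a stay (even \<open>m\<close>), so its coefficients and
  the numbers of walks satisfy the same recursion. The factor \<open>e\<^sup>t\<close> accounts for unrestricted stays.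
\<close>

section \<open>Shapes and local rules\<close>

definition shape :: "(nat \<Rightarrow> nat) \<Rightarrow> bool" where
  "shape v \<longleftrightarrow> antimono v \<and> (\<exists>i. v i = 0)"

text \<open>A shape is a partition given by its column lengths, so \<open>cover_row r\<close> adds a box in the
  (zero-based) row \<open>r\<close>, and the number of columns is the least \<open>l\<close> with \<open>v l = 0\<close>.\<close>
definition cover_row :: "nat \<Rightarrow> (nat \<Rightarrow> nat) \<Rightarrow> (nat \<Rightarrow> nat) \<Rightarrow> bool" where
  "cover_row r v w \<longleftrightarrow> shape v \<and> (\<exists>j. v j = r \<and> (\<forall>i<j. v i > r) \<and> w = v(j := Suc r))"

definition covers :: "(nat \<Rightarrow> nat) \<Rightarrow> (nat \<Rightarrow> nat) \<Rightarrow> bool" where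
  "covers v w \<longleftrightarrow> (\<exists>r. cover_row r v w)"

lemma shape_antimono: "shape v \<Longrightarrow> i \<le> j \<Longrightarrow> v j \<le> v i"
  by (auto simp: shape_def antimono_def)

lemma shape_zero [simp]: "shape (\<lambda>_. 0)"
  by (auto simp: shape_def antimono_def)

lemma cover_row_shape:
  assumes "cover_row r v w" shows "shape v" "shape w"
proof -
  obtain j where j: "shape v" "v j = r" "\<forall>i<j. v i > r" "w = v(j := Suc r)"
    using assms by (auto simp: cover_row_def)
  show "shape v" by fact
  obtain N where "v N = 0" using j(1) by (auto simp: shape_def)
  then have "v (max N (Suc j)) = 0"
    using shape_antimono[OF j(1), of N "max N (Suc j)"] by simp
  then have "w (max N (Suc j)) = 0" using j(4) by (auto simp: fun_upd_def)
  moreover have "antimono w"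
    unfolding antimono_def
  proof (intro allI impI)
    fix a b :: nat assume "a \<le> b"
    then show "w b \<le> w a"
      using shape_antimono[OF j(1), of a b] j(2,3,4)
      by (cases "a = j"; cases "b = j") (auto simp: Suc_le_eq)
  qed
  ultimately show "shape w" by (auto simp: shape_def)
qed

lemma cover_row_unique_upper:
  assumes "cover_row r v w" "cover_row r v w'" shows "w = w'"
proof -
  obtain j where j: "v j = r" "\<forall>i<j. v i > r" "w = v(j := Suc r)"
    using assms(1) by (auto simp: cover_row_def)
  obtain j' where j': "v j' = r" "\<forall>i<j'. v i > r" "w' = v(j' := Suc r)"
    using assms(2) by (auto simp: cover_row_def)
  have "j = j'" using j(1,2) j'(1,2) by (metis less_irrefl nat_neq_iff)
  then show ?thesis using j j' by simp
qed

text \<open>The raised column is the last one of height \<open>Suc r\<close> in \<open>w\<close>, so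
  \<open>r\<close> and \<open>w\<close> determine it.\<close>

lemma cover_row_unique_lower:
  assumes "cover_row r v w" "cover_row r v' w" shows "v = v'"
proof -
  obtain j where j: "shape v" "v j = r" "\<forall>i<j. v i > r" "w = v(j := Suc r)"
    using assms(1) by (auto simp: cover_row_def)
  obtain j' where j': "shape v'" "v' j' = r" "\<forall>i<j'. v' i > r" "w = v'(j' := Suc r)"
    using assms(2) by (auto simp: cover_row_def)
  have "w j = Suc r" using j by simp
  moreover have "w j' = Suc r" using j' by simp
  moreover have "w i \<le> r" if "i > j" for i
    using that j shape_antimono[OF j(1), of j i] by auto
  moreover have "w i \<le> r" if "i > j'" for i
    using that j' shape_antimono[OF j'(1), of j' i] by auto
  ultimately have "j = j'" by (metis Suc_n_not_le_n nat_neq_iff)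
  then have "v = w(j := r)" and "v' = w(j := r)" using j(2,4) j'(2,4) by (metis fun_upd_triv fun_upd_upd)+
  then show ?thesis by simp
qed

lemma cover_row_unique_row:
  assumes "cover_row r v w" "cover_row r' v w" shows "r = r'"
proof -
  obtain j where j: "v j = r" "w = v(j := Suc r)"
    using assms(1) by (auto simp: cover_row_def)
  obtain j' where j': "v j' = r'" "w = v(j' := Suc r')"
    using assms(2) by (auto simp: cover_row_def)
  have "j = j'" using j j' by (metis fun_upd_apply n_not_Suc_n)
  then show ?thesis using j j' by simp
qed

lemma cover_row_neq: "cover_row r v w \<Longrightarrow> v \<noteq> w"
  by (auto simp: cover_row_def fun_eq_iff)

lemma cover_row_le: "cover_row r v w \<Longrightarrow> v \<le> w"
  by (auto simp: cover_row_def le_fun_def)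

lemma cover_row_exists:
  assumes "shape v" "v j = r" shows "\<exists>w. cover_row r v w"
proof -
  \<comment> \<open>The box goes on the first column of height at most \<open>r\<close>; the given
    column \<open>j\<close> forces that height to be exactly \<open>r\<close>.\<close>
  let ?j = "LEAST i. v i \<le> r"
  have 1: "v ?j \<le> r" using assms(2) by (metis LeastI order_refl)
  have 2: "\<forall>i<?j. v i > r" by (meson not_less_Least not_le)
  have "?j \<le> j" using assms(2) by (intro Least_le) simp
  then have "v ?j \<ge> r" using shape_antimono[OF assms(1)] assms(2) by blast
  with 1 2 assms(1) show ?thesis unfolding cover_row_def by (intro exI[of _ "v(?j := Suc r)"]) auto
qed

lemma cover_row_zero_exists: "shape v \<Longrightarrow> \<exists>w. cover_row 0 v w"
  using cover_row_exists unfolding shape_def by blast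

lemma cover_row_Suc_exists: "cover_row r v w \<Longrightarrow> \<exists>u. cover_row (Suc r) w u"
proof -
  assume a: "cover_row r v w"
  then obtain j where "w j = Suc r" unfolding cover_row_def by (metis fun_upd_same)
  then show ?thesis using cover_row_exists cover_row_shape(2)[OF a] by blast
qed

text \<open>Needed to undo a bump: a column of height \<open>Suc r\<close> exists, and the last such
  column can lose its top box.\<close>

lemma cover_row_pred_exists:
  assumes "cover_row (Suc r) w u" shows "\<exists>v. cover_row r v w"
proof -
  obtain j where j: "shape w" "w j = Suc r" using assms by (auto simp: cover_row_def)
  obtain N where N: "w N = 0" using j by (auto simp: shape_def)
  let ?k = "LEAST i. w i \<le> r"
  have k1: "w ?k \<le> r" using N by (metis LeastI le0)
  have k2: "\<forall>i<?k. w i > r" by (meson not_less_Least not_le)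
  have kj: "j < ?k" using k1 j shape_antimono[OF j(1), of ?k j] by (metis Suc_n_not_le_n not_le order_trans)
  then obtain c where c: "?k = Suc c" by (cases ?k) auto
  have wc: "w c = Suc r"
    using k2 c kj shape_antimono[OF j(1), of j c] j(2) by (metis Suc_leI le_antisym lessI less_Suc_eq_le)
  let ?v = "w(c := r)"
  have "?v N' \<le> ?v i" if "i \<le> N'" for i N'
  proof (cases "i = c")
    case True
    then have "N' = c \<or> ?k \<le> N'" using that c by auto
    then show ?thesis using True k1 shape_antimono[OF j(1), of ?k N'] by auto
  next
    case False
    then show ?thesis using that shape_antimono[OF j(1), of i N'] wc by auto
  qed
  moreover have "?v N = 0" using N wc by auto
  ultimately have "shape ?v" unfolding shape_def antimono_def by blast
  moreover have "\<forall>i<c. ?v i > r" using k2 c by auto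
  ultimately have "cover_row r ?v w" unfolding cover_row_def using wc by (auto intro!: exI[of _ c])
  then show ?thesis by blast
qed

text \<open>Distinct rows act on distinct columns, and updates at distinct columns commute.\<close>

lemma cover_row_diamond_up:
  assumes "cover_row r a b" "cover_row s a c" "r \<noteq> s"
  shows "\<exists>d. cover_row s b d \<and> cover_row r c d"
proof -
  obtain j where j: "shape a" "a j = r" "\<forall>i<j. a i > r" "b = a(j := Suc r)"
    using assms(1) by (auto simp: cover_row_def)
  obtain k where k: "a k = s" "\<forall>i<k. a i > s" "c = a(k := Suc s)"
    using assms(2) by (auto simp: cover_row_def)
  have jk: "j \<noteq> k" using assms j k by auto
  have "b k = s" "c j = r" using j k jk by auto
  moreover have "\<forall>i<k. b i > s" "\<forall>i<j. c i > r"
    using j k jk by (auto simp: less_Suc_eq)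
  moreover have "b(k := Suc s) = c(j := Suc r)" using j k jk by (auto simp: fun_eq_iff)
  ultimately show ?thesis
    using cover_row_shape(2)[OF assms(1)] cover_row_shape(2)[OF assms(2)]
    unfolding cover_row_def by (intro exI[of _ "b(k := Suc s)"]) auto
qed

lemma cover_row_diamond_down:
  assumes "cover_row s b d" "cover_row r c d" "r \<noteq> s"
  shows "\<exists>a. cover_row r a b \<and> cover_row s a c"
proof -
  obtain k where k: "shape b" "b k = s" "\<forall>i<k. b i > s" "d = b(k := Suc s)"
    using assms(1) by (auto simp: cover_row_def)
  obtain j where j: "shape c" "c j = r" "\<forall>i<j. c i > r" "d = c(j := Suc r)"
    using assms(2) by (auto simp: cover_row_def)
  have jk: "j \<noteq> k" using assms j k by (metis fun_upd_same nat.inject)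
  have bj: "b j = Suc r" and ck: "c k = Suc s" using j k jk by (metis fun_upd_apply)+
  have bc: "b i = c i" if "i \<noteq> j" "i \<noteq> k" for i using j k that by (metis fun_upd_apply)
  \<comment> \<open>The lower corner is the meet of \<open>b\<close> and \<open>c\<close> in Young's
    lattice.\<close>
  let ?a = "\<lambda>i. min (b i) (c i)"
  have anti: "?a y \<le> ?a x" if "x \<le> y" for x y
    using shape_antimono[OF k(1) that] shape_antimono[OF j(1) that] by auto
  obtain N where "b N = 0" using k by (auto simp: shape_def)
  then have "?a N = 0" by simp
  then have "shape ?a" using anti unfolding shape_def antimono_def by blast
  moreover have aj: "?a j = r" and ak: "?a k = s" using bj ck j k by auto
  moreover have "\<forall>i<j. ?a i > r"
  proof (intro allI impI)
    fix i assume "i < j"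
    then have "c i > r" "b i \<ge> Suc r" using j(3) shape_antimono[OF k(1), of i j] bj by auto
    then show "?a i > r" by simp
  qed
  moreover have "\<forall>i<k. ?a i > s"
  proof (intro allI impI)
    fix i assume "i < k"
    then have "b i > s" "c i \<ge> Suc s" using k(3) shape_antimono[OF j(1), of i k] ck by auto
    then show "?a i > s" by simp
  qed
  moreover have "b x = (?a(j := Suc r)) x" "c x = (?a(k := Suc s)) x" for x
    by (cases "x = j"; cases "x = k"; use bc[of x] bj ck j(2) k(2) jk in auto)+
  then have "b = ?a(j := Suc r)" "c = ?a(k := Suc s)" by blast+
  ultimately show ?thesis unfolding cover_row_def by blast
qed

abbreviation step :: "(nat \<Rightarrow> nat) \<Rightarrow> (nat \<Rightarrow> nat) \<Rightarrow> bool" where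
  "step v w \<equiv> shape v \<and> shape w \<and> (v = w \<or> covers v w)"

text \<open>Fomin's local rule for the square with corners \<open>a\<close> (smallest), \<open>b\<close>, \<open>c\<close>, \<open>d\<close> (largest);
  the flag says whether the square contains an arc.\<close>
inductive local_rule :: "bool \<Rightarrow> (nat \<Rightarrow> nat) \<Rightarrow> (nat \<Rightarrow> nat) \<Rightarrow> (nat \<Rightarrow> nat) \<Rightarrow> (nat \<Rightarrow> nat) \<Rightarrow> bool" where
  arc: "cover_row 0 a d \<Longrightarrow> local_rule True a a a d"
| left: "step a c \<Longrightarrow> local_rule False a a c c"
| right: "covers a b \<Longrightarrow> local_rule False a b a b"
| bump: "cover_row r a b \<Longrightarrow> cover_row (Suc r) b d \<Longrightarrow> local_rule False a b b d"
| diamond: "r \<noteq> s \<Longrightarrow> cover_row r a b \<Longrightarrow> cover_row s a c \<Longrightarrow> cover_row s b d \<Longrightarrow> cover_row r c d \<Longrightarrow>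
    local_rule False a b c d"

lemma local_rule_step:
  assumes "local_rule x a b c d"
  shows "step a b" "step a c" "step b d" "step c d"
  using assms by (cases; auto simp: covers_def dest: cover_row_shape)+

text \<open>Opposite sides of a square are trivial or nontrivial together, except around an arc:
  there the sides at \<open>a\<close> are trivial and the sides at \<open>d\<close> are not.\<close>

lemma local_rule_change:
  assumes "local_rule x a b c d"
  shows "d \<noteq> c \<longleftrightarrow> x \<or> b \<noteq> a" "d \<noteq> b \<longleftrightarrow> x \<or> c \<noteq> a" "x \<Longrightarrow> a = b \<and> a = c"
  using assms by (cases; auto simp: covers_def dest: cover_row_neq)+

text \<open>If both given sides are nontrivial, equal rows force \<open>b = c\<close> and call for
  \<open>bump\<close>, distinct rows for \<open>diamond\<close>. This existence justifies the choice
  in \<open>grow\<close>.\<close>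

lemma local_rule_forward:
  assumes "step a b" "step a c" "x \<Longrightarrow> a = b \<and> a = c"
  shows "\<exists>d. local_rule x a b c d"
proof (cases "x \<or> a = b \<or> a = c")
  case True
  then show ?thesis using assms cover_row_zero_exists by (metis arc left right)
next
  case False
  then obtain r s where rs: "cover_row r a b" "cover_row s a c" using assms by (auto simp: covers_def)
  show ?thesis
  proof (cases "r = s")
    case True
    then have "b = c" using rs cover_row_unique_upper by blast
    then show ?thesis using rs cover_row_Suc_exists[OF rs(1)] False by (metis bump)
  next
    case neq: False
    then show ?thesis using cover_row_diamond_up[OF rs neq] rs False by (metis diamond)
  qed
qed

text \<open>If \<open>b\<close> and \<open>c\<close> lie strictly below \<open>d\<close> by a box in
  the same row, they coincide and the row decides: row 0 comes from an arc, any later row from a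
  bump.\<close>

lemma local_rule_backward:
  assumes "step b d" "step c d"
  shows "\<exists>x a. local_rule x a b c d"
proof (cases "b = d \<or> c = d")
  case True
  then show ?thesis using assms by (metis left right)
next
  case False
  then obtain r s where rs: "cover_row s b d" "cover_row r c d" using assms by (auto simp: covers_def)
  show ?thesis
  proof (cases "r = s")
    case True
    then have "b = c" using rs cover_row_unique_lower by blast
    then show ?thesis using rs by (metis arc bump cover_row_pred_exists not0_implies_Suc)
  next
    case neq: False
    then show ?thesis using cover_row_diamond_down[OF rs neq] rs by (metis diamond)
  qed
qed

text \<open>The rule in force is visible from which of \<open>b\<close>, \<open>c\<close>,
  \<open>d\<close> coincide and, when \<open>b = c\<close> is strictly below \<open>d\<close>, from
  whether the new box is in row 0. Thus arcs can be read off from shapes.\<close>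

lemma local_rule_backward_unique:
  assumes "local_rule x a b c d" "local_rule x' a' b c d"
  shows "x = x' \<and> a = a'"
  using assms(1)
proof cases
  case arc
  show ?thesis using assms(2)
    by cases (use arc in \<open>auto dest: cover_row_neq cover_row_unique_row simp: covers_def\<close>)
next
  case left
  show ?thesis using assms(2)
    by cases (use left in \<open>auto dest: cover_row_neq simp: covers_def\<close>)
next
  case right
  show ?thesis using assms(2)
    by cases (use right in \<open>auto dest: cover_row_neq simp: covers_def\<close>)
next
  case (bump r)
  show ?thesis using assms(2)
    by cases (use bump in \<open>auto dest: cover_row_neq cover_row_unique_row cover_row_unique_lower\<close>)
next
  case (diamond r s)
  show ?thesis using assms(2)
    by cases (use diamond in \<open>auto dest: cover_row_neq cover_row_unique_row cover_row_unique_lower\<close>)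
qed

lemma local_rule_forward_unique:
  assumes "local_rule x a b c d" "local_rule x a b c d'"
  shows "d = d'"
  using assms(1)
proof cases
  case arc
  show ?thesis using assms(2)
    by cases (use arc in \<open>auto dest: cover_row_unique_upper\<close>)
next
  case left
  show ?thesis using assms(2)
    by cases (use left in \<open>auto dest: cover_row_neq simp: covers_def\<close>)
next
  case right
  show ?thesis using assms(2)
    by cases (use right in \<open>auto dest: cover_row_neq simp: covers_def\<close>)
next
  case (bump r)
  show ?thesis using assms(2)
    by cases (use bump in \<open>auto dest: cover_row_neq cover_row_unique_row cover_row_unique_upper\<close>)
next
  case (diamond r s)
  show ?thesis using assms(2)
    by cases (use diamond in \<open>auto dest: cover_row_neq cover_row_unique_row cover_row_unique_upper\<close>)
qed

text \<open>The number of nonzero entries of a shape obeys the same recursion as the largest nesting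
  (\<open>nesting_Suc\<close> below).\<close>
lemma local_rule_pos:
  assumes "local_rule x a b c d"
  shows "d r > 0 \<longleftrightarrow> b r > 0 \<or> c r > 0 \<or> (x \<and> (r = 0 \<or> a (r - 1) > 0))"
  using assms
proof cases
  case arc
  then obtain j where j: "a j = 0" "\<forall>i<j. a i > 0" "d = a(j := 1)" "shape a" by (auto simp: cover_row_def)
  have z: "a i = 0" if "i \<ge> j" for i using shape_antimono[OF j(4) that] j(1) by auto
  have "d r > 0 \<longleftrightarrow> r \<le> j" using z[of r] j by (cases "r \<le> j") (auto simp: le_less)
  moreover have "r = 0 \<or> a (r - 1) > 0 \<longleftrightarrow> r \<le> j"
    using z[of "r - 1"] j(2) by (cases r; cases "j \<le> r - 1") auto
  moreover have "a r > 0 \<longrightarrow> r \<le> j" using z[of r] by (cases "j \<le> r") auto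
  ultimately show ?thesis using arc by auto
next
  case (bump s)
  then obtain j where j: "b j = Suc s" "d = b(j := Suc (Suc s))" by (auto simp: cover_row_def)
  then show ?thesis using bump by auto
next
  case (diamond p q)
  then have "\<exists>k. d = b(k := Suc q) \<and> b k = q" "\<exists>k. c = a(k := Suc q) \<and> a k = q" by (auto simp: cover_row_def)
  then obtain k k' where k: "d = b(k := Suc q)" "b k = q" "c = a(k' := Suc q)" "a k' = q" by auto
  obtain j where j: "b = a(j := Suc p)" "a j = p" using diamond(3) by (auto simp: cover_row_def)
  obtain j' where j': "d = c(j' := Suc p)" "c j' = p" using diamond by (auto simp: cover_row_def)
  show ?thesis using diamond(1,2) k j j' by (metis fun_upd_apply zero_less_Suc)
next
  case left
  then have "a \<le> c" by (auto simp: covers_def dest: cover_row_le)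
  then have "a r \<le> c r" by (simp add: le_fun_def)
  then show ?thesis using left by auto
next
  case right
  then have "a \<le> b" by (auto simp: covers_def dest: cover_row_le)
  then have "a r \<le> b r" by (simp add: le_fun_def)
  then show ?thesis using right by auto
qed

section \<open>Growth diagrams and nestings\<close>

text \<open>The shape \<open>g a b\<close> records the arcs with opener at most \<open>a\<close> and closer greater than \<open>b\<close>.\<close>
definition growth :: "(nat \<Rightarrow> nat) \<Rightarrow> (nat \<Rightarrow> nat \<Rightarrow> nat \<Rightarrow> nat) \<Rightarrow> bool" where
  "growth \<tau> g \<longleftrightarrow> (\<forall>a b. a < b \<longrightarrow>
     local_rule (\<tau> (Suc a) = Suc b) (g a (Suc b)) (g (Suc a) (Suc b)) (g a b) (g (Suc a) b))"

locale involution =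
  fixes n :: nat and \<tau> :: "nat \<Rightarrow> nat"
  assumes permutes: "\<tau> permutes {1..n}" and invol: "\<tau> \<circ> \<tau> = id"
begin

lemma tau_tau [simp]: "\<tau> (\<tau> i) = i"
  using invol by (metis comp_apply id_apply)

lemma tau_eq_iff: "\<tau> i = \<tau> j \<longleftrightarrow> i = j"
  by (metis tau_tau)

lemma tau_le: "i \<le> n \<Longrightarrow> \<tau> i \<le> n"
  using permutes_in_image[OF permutes, of i] permutes_not_in[OF permutes, of i] by fastforce

lemma tau_gt: "i > n \<Longrightarrow> \<tau> i = i"
  using permutes_not_in[OF permutes, of i] by auto

lemma tau_pos: "i > 0 \<Longrightarrow> \<tau> i > 0"
  using permutes_not_in[OF permutes, of 0] by (metis atLeastAtMost_iff gr0I tau_tau not_one_le_zero)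

text \<open>The second argument counts down from \<open>n\<close>: \<open>grow a k\<close> is the shape at \<open>(a, n - k)\<close>.\<close>
fun grow :: "nat \<Rightarrow> nat \<Rightarrow> nat \<Rightarrow> nat" where
  "grow 0 k = (\<lambda>_. 0)"
| "grow (Suc a) 0 = (\<lambda>_. 0)"
| "grow (Suc a) (Suc k) = (SOME d. local_rule (\<tau> (Suc a) = n - k) (grow a k) (grow (Suc a) k) (grow a (Suc k)) d)"

declare grow.simps(3) [simp del]

definition g :: "nat \<Rightarrow> nat \<Rightarrow> nat \<Rightarrow> nat" where
  "g a b = grow a (n - b)"

lemma grow_0: "grow a 0 = (\<lambda>_. 0)"
  by (cases a) auto

text \<open>The grid is filled as a whole, so fixed points and mirror images of arcs mark cells too.
  Knowing which edges are nontrivial shows that a marked cell has trivial edges at its smallest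
  corner, as \<open>local_rule_forward\<close> demands; hence the three claims are proved
  jointly.\<close>

lemma grow_invariant:
  assumes "k \<le> n"
  shows "step (grow a k) (grow (Suc a) k) \<and> (grow a k \<noteq> grow (Suc a) k \<longleftrightarrow> n - k < \<tau> (Suc a) \<and> \<tau> (Suc a) \<le> n)"
    and "k < n \<Longrightarrow> step (grow a k) (grow a (Suc k)) \<and> (grow a k \<noteq> grow a (Suc k) \<longleftrightarrow> \<tau> (n - k) \<le> a)"
    and "k < n \<Longrightarrow> local_rule (\<tau> (Suc a) = n - k) (grow a k) (grow (Suc a) k) (grow a (Suc k)) (grow (Suc a) (Suc k))"
proof -
  let ?x = "\<lambda>a k. \<tau> (Suc a) = n - k"
  let ?C = "\<lambda>a k. step (grow a k) (grow (Suc a) k) \<and> (grow a k \<noteq> grow (Suc a) k \<longleftrightarrow> n - k < \<tau> (Suc a) \<and> \<tau> (Suc a) \<le> n)"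
  let ?R = "\<lambda>a k. step (grow a k) (grow a (Suc k)) \<and> (grow a k \<noteq> grow a (Suc k) \<longleftrightarrow> \<tau> (n - k) \<le> a)"
  let ?L = "\<lambda>a k. local_rule (?x a k) (grow a k) (grow (Suc a) k) (grow a (Suc k)) (grow (Suc a) (Suc k))"
  have L: "?L a k" if "?C a k" "?R a k" "k < n" for a k
  proof -
    have "?x a k \<Longrightarrow> grow a k = grow (Suc a) k \<and> grow a k = grow a (Suc k)"
      using that by (metis Suc_n_not_le_n tau_tau less_irrefl)
    then show ?thesis using local_rule_forward[of "grow a k" "grow (Suc a) k" "grow a (Suc k)" "?x a k"] that
      unfolding grow.simps(3) by (metis someI_ex)
  qed
  have C: "?C a (Suc k)" if "?L a k" "?C a k" "k < n" for a k
  proof -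
    have "n - Suc k < \<tau> (Suc a) \<longleftrightarrow> n - k < \<tau> (Suc a) \<or> ?x a k" using that(3) by linarith
    moreover have "grow a (Suc k) \<noteq> grow (Suc a) (Suc k) \<longleftrightarrow> ?x a k \<or> n - k < \<tau> (Suc a) \<and> \<tau> (Suc a) \<le> n"
      using local_rule_change(1)[OF that(1)] that(2) by metis
    ultimately show ?thesis using local_rule_step(4)[OF that(1)] diff_le_self[of n k] by metis
  qed
  have R: "?R (Suc a) k" if "?L a k" "?R a k" "k < n" for a k
  proof -
    have "\<tau> (n - k) = Suc a \<longleftrightarrow> ?x a k" by (metis tau_tau)
    then have "\<tau> (n - k) \<le> Suc a \<longleftrightarrow> \<tau> (n - k) \<le> a \<or> ?x a k" by (auto simp: le_Suc_eq)
    moreover have "grow (Suc a) k \<noteq> grow (Suc a) (Suc k) \<longleftrightarrow> ?x a k \<or> \<tau> (n - k) \<le> a"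
      using local_rule_change(2)[OF that(1)] that(2) by metis
    ultimately show ?thesis using local_rule_step(3)[OF that(1)] by metis
  qed
  have C0: "?C a 0" for a by (simp add: grow_0)
  have R0: "?R 0 k" if "k < n" for k using tau_pos[of "n - k"] that by simp
  \<comment> \<open>The outer induction is on \<open>k\<close>; the inner one, on \<open>a\<close>,
    carries the row claim across one cell at a time.\<close>
  have all: "?C a k \<and> (k < n \<longrightarrow> ?R a k)" if "k \<le> n" for a k
    using that
  proof (induction k arbitrary: a)
    case 0
    have "?R a 0" if "0 < n" for a
      by (induction a) (use R0[of 0] R C0 L that in blast)+
    then show ?case using C0 by blast
  next
    case (Suc k)
    have CS: "?C a (Suc k)" for a using Suc C L by auto
    have "?R a (Suc k)" if "Suc k < n" for a
      by (induction a) (use R0[of "Suc k"] R CS L that in blast)+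
    then show ?case using CS by blast
  qed
  show "?C a k" using all assms by blast
  show "k < n \<Longrightarrow> ?R a k" "k < n \<Longrightarrow> ?L a k" using all assms L by blast+
qed

lemma growth_g: "growth \<tau> g"
  unfolding growth_def
proof (intro allI impI)
  fix a b :: nat assume ab: "a < b"
  show "local_rule (\<tau> (Suc a) = Suc b) (g a (Suc b)) (g (Suc a) (Suc b)) (g a b) (g (Suc a) b)"
  proof (cases "b < n")
    case True
    then have "n - b = Suc (n - Suc b)" "n - (n - Suc b) = Suc b" by auto
    then show ?thesis using grow_invariant(3)[of "n - Suc b" a] True by (simp add: g_def)
  next
    case False
    \<comment> \<open>From \<open>b = n\<close> on all shapes are empty, so only the absence of an
      arc has to be checked.\<close>
    have "\<tau> (Suc a) \<noteq> Suc b"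
    proof
      assume "\<tau> (Suc a) = Suc b"
      moreover have "\<tau> (Suc b) = Suc b" using False tau_gt by auto
      ultimately have "Suc a = Suc b" by (metis tau_tau)
      with ab show False by simp
    qed
    then show ?thesis using False local_rule.left[of "\<lambda>_. 0" "\<lambda>_. 0"] by (simp add: g_def grow_0)
  qed
qed

text \<open>Together with \<open>g_step_row\<close>: the diagonal step at \<open>Suc i\<close>
  passes through the lower shape \<open>g i (Suc i)\<close>. A closer uses the first half, an opener
  the second, a fixed point neither.\<close>

lemma g_step_col:
  assumes "i < n"
  shows "step (g i (Suc i)) (g (Suc i) (Suc i))"
    and "g i (Suc i) \<noteq> g (Suc i) (Suc i) \<longleftrightarrow> Suc i < \<tau> (Suc i)"
  using grow_invariant(1)[of "n - Suc i" i] assms tau_le[of "Suc i"] by (auto simp: g_def)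

lemma g_step_row:
  assumes "i < n"
  shows "step (g i (Suc i)) (g i i)"
    and "g i (Suc i) \<noteq> g i i \<longleftrightarrow> \<tau> (Suc i) \<le> i"
proof -
  have "n - i = Suc (n - Suc i)" "n - (n - Suc i) = Suc i" using assms by auto
  then show "step (g i (Suc i)) (g i i)"
    and "g i (Suc i) \<noteq> g i i \<longleftrightarrow> \<tau> (Suc i) \<le> i"
    using grow_invariant(2)[of "n - Suc i" i] assms by (auto simp: g_def)
qed

text \<open>For \<open>a\<close> \<le> \<open>b\<close> the set \<open>S\<close> holds the openers
  of \<open>r\<close> nested arcs. For larger \<open>a\<close> it may also contain fixed points and
  closers, in keeping with \<open>grow\<close> living on the whole grid.\<close>

definition nesting :: "nat \<Rightarrow> nat \<Rightarrow> nat \<Rightarrow> bool" where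
  "nesting r a b \<longleftrightarrow> (\<exists>S. card S = r \<and> S \<subseteq> {1..a} \<and> \<tau> ` S \<subseteq> {b<..n} \<and> strict_antimono_on S \<tau>)"

lemma nesting_0: "nesting 0 a b"
  unfolding nesting_def by (intro exI[of _ "{}"]) auto

lemma nesting_left_0: "\<not> nesting (Suc r) 0 b"
  by (auto simp: nesting_def)

lemma nesting_right_n: "\<not> nesting (Suc r) a n"
  by (auto simp: nesting_def)

lemma nesting_mono: "nesting r a b \<Longrightarrow> a \<le> a' \<Longrightarrow> b' \<le> b \<Longrightarrow> nesting r a' b'"
  unfolding nesting_def by (elim exE) (rule exI, force)

text \<open>If \<open>Suc a\<close> is in \<open>S\<close>, it is the largest element and its image
  is the least. If that image is not \<open>Suc b\<close>, all images exceed \<open>Suc b\<close>;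
  if it is, removing this innermost pair leaves \<open>r\<close> elements.\<close>

lemma nesting_Suc:
  "nesting (Suc r) (Suc a) b \<longleftrightarrow> nesting (Suc r) a b \<or> nesting (Suc r) (Suc a) (Suc b) \<or>
     (\<tau> (Suc a) = Suc b \<and> b < n \<and> nesting r a (Suc b))"
proof
  assume "nesting (Suc r) (Suc a) b"
  then obtain S where S: "card S = Suc r" "S \<subseteq> {1..Suc a}" "\<tau> ` S \<subseteq> {b<..n}" "strict_antimono_on S \<tau>"
    by (auto simp: nesting_def)
  have tS: "\<tau> x > \<tau> (Suc a)" if "x \<in> S - {Suc a}" "Suc a \<in> S" for x
    using that S(2) by (intro monotone_onD[OF S(4)]) auto
  consider "Suc a \<notin> S" | "Suc a \<in> S" "\<tau> (Suc a) \<noteq> Suc b" | "Suc a \<in> S" "\<tau> (Suc a) = Suc b" by blast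
  then show "nesting (Suc r) a b \<or> nesting (Suc r) (Suc a) (Suc b) \<or>
     (\<tau> (Suc a) = Suc b \<and> b < n \<and> nesting r a (Suc b))"
  proof cases
    case 1
    then have "S \<subseteq> {1..a}" using S(2) by (auto simp: le_Suc_eq)
    then show ?thesis using S unfolding nesting_def by blast
  next
    case 2
    then have "\<tau> (Suc a) > Suc b" using S(3) by force
    then have "\<tau> ` S \<subseteq> {Suc b<..n}" using S(3) tS 2 by force
    then show ?thesis using S unfolding nesting_def by blast
  next
    case 3
    have "S - {Suc a} \<subseteq> {1..a}" using S(2) by (auto simp: le_Suc_eq)
    moreover have "\<tau> ` (S - {Suc a}) \<subseteq> {Suc b<..n}" using S(3) tS 3 by force
    moreover have "card (S - {Suc a}) = r" using S(1) 3 by simp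
    moreover have "strict_antimono_on (S - {Suc a}) \<tau>" using S(4) by (rule monotone_on_subset) auto
    ultimately have "nesting r a (Suc b)" unfolding nesting_def by blast
    then show ?thesis using 3 S(3) by force
  qed
next
  assume "nesting (Suc r) a b \<or> nesting (Suc r) (Suc a) (Suc b) \<or>
     (\<tau> (Suc a) = Suc b \<and> b < n \<and> nesting r a (Suc b))"
  then consider "nesting (Suc r) (Suc a) b" | "\<tau> (Suc a) = Suc b" "b < n" "nesting r a (Suc b)"
    using nesting_mono[of "Suc r" a b "Suc a" b] nesting_mono[of "Suc r" "Suc a" "Suc b" "Suc a" b] by auto
  then show "nesting (Suc r) (Suc a) b"
  proof cases
    case 2
    then obtain S where S: "card S = r" "S \<subseteq> {1..a}" "\<tau> ` S \<subseteq> {Suc b<..n}" "strict_antimono_on S \<tau>"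
      by (auto simp: nesting_def)
    have "finite S" using S(2) finite_subset by blast
    moreover have "Suc a \<notin> S" using S(2) by auto
    ultimately have "card (insert (Suc a) S) = Suc r" using S(1) by simp
    moreover have "strict_antimono_on (insert (Suc a) S) \<tau>"
    proof (rule monotone_onI)
      fix x y assume "x \<in> insert (Suc a) S" "y \<in> insert (Suc a) S" "x < y"
      then show "\<tau> x > \<tau> y" using S(2,3) 2(1) monotone_onD[OF S(4), of x y] by force
    qed
    moreover have "insert (Suc a) S \<subseteq> {1..Suc a}" "\<tau> ` insert (Suc a) S \<subseteq> {b<..n}" using S 2 by force+
    ultimately show ?thesis unfolding nesting_def by blast
  qed
qed

text \<open>\<open>local_rule_pos\<close> and \<open>nesting_Suc\<close> are the same recursion with
  the same boundary values; the alternative \<open>r = 0\<close> there corresponds to the empty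
  nesting.\<close>

lemma grow_nesting: "k \<le> n \<Longrightarrow> grow a k r > 0 \<longleftrightarrow> nesting (Suc r) a (n - k)"
proof (induction k arbitrary: a r)
  case 0
  then show ?case by (simp add: grow_0 nesting_right_n)
next
  case (Suc k)
  have "n - k = Suc (n - Suc k)" "n - Suc k < n" "k < n" using Suc.prems by auto
  note k = this
  show ?case
  proof (induction a arbitrary: r)
    case 0
    then show ?case by (simp add: nesting_left_0)
  next
    case (Suc a)
    show ?case
      unfolding local_rule_pos[OF grow_invariant(3)[of k a, OF less_imp_le[OF k(3)] k(3)]]
        nesting_Suc[of r a "n - Suc k"] Suc.IH
      using Suc.IH k \<open>\<And>a r. k \<le> n \<Longrightarrow> (0 < grow a k r) = nesting (Suc r) a (n - k)\<close>
      by (cases r) (auto simp: nesting_0)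
  qed
qed

lemma g_nesting: "b \<le> n \<Longrightarrow> g a b r > 0 \<longleftrightarrow> nesting (Suc r) a b"
  using grow_nesting[of "n - b" a r] by (simp add: g_def)

section \<open>Descending subsequences in terms of nested arcs\<close>

lemma has_descending_iff:
  "has_descending_subsequence k (n, \<tau>) \<longleftrightarrow> (\<exists>S. card S = k \<and> S \<subseteq> {1..n} \<and> strict_antimono_on S \<tau>)"
proof
  assume "has_descending_subsequence k (n, \<tau>)"
  then obtain xs where xs: "length xs = k" "set xs \<subseteq> {1..n}" "sorted_wrt (<) xs" "sorted_wrt (>) (map \<tau> xs)"
    by (auto simp: has_descending_subsequence_def)
  have "distinct xs" using xs(3) strict_sorted_iff by blast
  then have "card (set xs) = k" using xs(1) distinct_card by blast
  moreover have "strict_antimono_on (set xs) \<tau>"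
  proof (rule monotone_onI)
    fix x y assume "x \<in> set xs" "y \<in> set xs" "x < y"
    then obtain i j where ij: "i < length xs" "j < length xs" "xs ! i = x" "xs ! j = y" by (auto simp: in_set_conv_nth)
    have "i < j" using ij \<open>x < y\<close> xs(3) by (metis less_asym nat_neq_iff sorted_wrt_nth_less)
    then show "\<tau> x > \<tau> y" using ij sorted_wrt_nth_less[OF xs(4), of i j] by simp
  qed
  ultimately show "\<exists>S. card S = k \<and> S \<subseteq> {1..n} \<and> strict_antimono_on S \<tau>" using xs(2) by blast
next
  assume "\<exists>S. card S = k \<and> S \<subseteq> {1..n} \<and> strict_antimono_on S \<tau>"
  then obtain S where S: "card S = k" "S \<subseteq> {1..n}" "strict_antimono_on S \<tau>" by blast
  let ?xs = "sorted_list_of_set S"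
  have fin: "finite S" using S(2) finite_subset by blast
  have "sorted_wrt (<) ?xs" by simp
  moreover from this have "sorted_wrt (\<lambda>x y. \<tau> x > \<tau> y) ?xs"
    by (rule sorted_wrt_mono_rel[rotated]) (use fin monotone_onD[OF S(3)] in auto)
  ultimately show "has_descending_subsequence k (n, \<tau>)"
    unfolding has_descending_subsequence_def using S fin by (auto simp: sorted_wrt_map intro!: exI[of _ ?xs])
qed

text \<open>Reflection in the main diagonal preserves the graph of an involution and descending
  patterns, and it exchanges closers with openers.\<close>

lemma antimono_image: "strict_antimono_on S \<tau> \<Longrightarrow> strict_antimono_on (\<tau> ` S) \<tau>"
  unfolding monotone_on_def by (metis (no_types, lifting) image_iff less_asym nat_neq_iff tau_tau)

text \<open>Keep \<open>r\<close> of the openers and cut at the last one: its partner is the least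
  closer, so all openers lie up to the cut and all closers beyond it.\<close>

lemma nesting_if_openers:
  assumes "T \<subseteq> {1..n}" "strict_antimono_on T \<tau>" "\<And>x. x \<in> T \<Longrightarrow> x < \<tau> x" "card T \<ge> r" "r > 0"
  shows "\<exists>i\<le>n. nesting r i i"
proof -
  obtain S where S: "S \<subseteq> T" "card S = r" "finite S" using obtain_subset_with_card_n[OF assms(4)] by blast
  then have ne: "S \<noteq> {}" using assms(5) by auto
  then have m: "Max S \<in> S" using S Max_in by blast
  have anti: "strict_antimono_on S \<tau>" using assms(2) S(1) by (rule monotone_on_subset)
  have gt: "\<tau> x > Max S" if "x \<in> S" for x
  proof (cases "x = Max S")
    case True then show ?thesis using assms(3) m S by force
  next
    case False
    then have "x < Max S" using that S by (simp add: le_neq_trans)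
    then have "\<tau> (Max S) < \<tau> x" using monotone_onD[OF anti] that m by blast
    then show ?thesis using assms(3)[of "Max S"] m S(1) by auto
  qed
  have le: "\<tau> x \<le> n" if "x \<in> S" for x
    using subsetD[OF assms(1) subsetD[OF S(1) that]] tau_le by simp
  have "S \<subseteq> {1..Max S}"
  proof
    fix x assume "x \<in> S"
    moreover from this have "x \<in> {1..n}" using S(1) assms(1) by blast
    ultimately show "x \<in> {1..Max S}" using Max_ge[OF S(3)] by auto
  qed
  moreover have "\<tau> ` S \<subseteq> {Max S<..n}" using gt le by auto
  ultimately have "nesting r (Max S) (Max S)" unfolding nesting_def using S(2) anti by blast
  moreover have "Max S \<le> n" using subsetD[OF assms(1) subsetD[OF S(1) m]] by simp
  ultimately show ?thesis by blast
qed

text \<open>The openers of a nesting followed by its closers descend throughout, so a nesting yields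
  a descending set of twice its size.\<close>

lemma antimono_union_image:
  assumes "S \<subseteq> {1..i}" "\<tau> ` S \<subseteq> {j<..n}" "i \<le> j" "strict_antimono_on S \<tau>"
  shows "strict_antimono_on (S \<union> \<tau> ` S) \<tau>" "card (S \<union> \<tau> ` S) = 2 * card S"
proof -
  have fin: "finite S" using assms(1) finite_subset by blast
  have "S \<inter> \<tau> ` S = {}" using assms(1,2,3) by force
  moreover have "card (\<tau> ` S) = card S" by (intro card_image inj_onI) (simp add: tau_eq_iff)
  ultimately show "card (S \<union> \<tau> ` S) = 2 * card S" using fin by (simp add: card_Un_disjoint)
  show "strict_antimono_on (S \<union> \<tau> ` S) \<tau>"
  proof (rule monotone_onI)
    fix x y assume xy: "x \<in> S \<union> \<tau> ` S" "y \<in> S \<union> \<tau> ` S" "x < y"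
    consider "x \<in> S" "y \<in> S" | "x \<in> \<tau> ` S" "y \<in> \<tau> ` S" | "x \<in> S" "y \<in> \<tau> ` S" | "x \<in> \<tau> ` S" "y \<in> S"
      using xy by blast
    then show "\<tau> x > \<tau> y"
    proof cases
      case 1 then show ?thesis using xy monotone_onD[OF assms(4)] by blast
    next
      case 2 then show ?thesis using xy monotone_onD[OF antimono_image[OF assms(4)]] by blast
    next
      case 3
      then have "\<tau> y \<in> S" by auto
      then show ?thesis using 3 assms(1,2,3) by force
    next
      case 4 then show ?thesis using xy assms(1,2,3) by force
    qed
  qed
qed

text \<open>Two fixed points would form an ascent, so there is at most one. Closers are counted
  through their partners, which are openers.\<close>

lemma descending_parts:
  assumes "card S = k" "S \<subseteq> {1..n}" "strict_antimono_on S \<tau>"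
  shows "\<exists>F. F = {x \<in> S. \<tau> x = x} \<and> card F \<le> 1 \<and>
     k = card {x \<in> S. x < \<tau> x} + card F + card (\<tau> ` {x \<in> S. \<tau> x < x})"
proof -
  have fin: "finite S" using assms(2) finite_subset by blast
  have "x = y" if "x \<in> S" "y \<in> S" "\<tau> x = x" "\<tau> y = y" for x y
    using that monotone_onD[OF assms(3), of x y] monotone_onD[OF assms(3), of y x] by (metis less_asym nat_neq_iff)
  then have "card {x \<in> S. \<tau> x = x} \<le> 1" using fin by (auto simp: card_le_Suc0_iff_eq)
  moreover have "S = {x \<in> S. x < \<tau> x} \<union> ({x \<in> S. \<tau> x = x} \<union> {x \<in> S. \<tau> x < x})" by auto
  then have "k = card ({x \<in> S. x < \<tau> x} \<union> ({x \<in> S. \<tau> x = x} \<union> {x \<in> S. \<tau> x < x}))" using assms(1) by simp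
  then have "k = card {x \<in> S. x < \<tau> x} + (card {x \<in> S. \<tau> x = x} + card {x \<in> S. \<tau> x < x})"
    using fin by (subst (asm) card_Un_disjoint, simp, simp, force, subst (asm) card_Un_disjoint) auto
  moreover have "card (\<tau> ` {x \<in> S. \<tau> x < x}) = card {x \<in> S. \<tau> x < x}"
    by (intro card_image inj_onI) (simp add: tau_eq_iff)
  ultimately show ?thesis by simp
qed

lemma descending_openers:
  assumes "S \<subseteq> {1..n}" "strict_antimono_on S \<tau>" "r > 0"
    and "card {x \<in> S. x < \<tau> x} \<ge> r \<or> card (\<tau> ` {x \<in> S. \<tau> x < x}) \<ge> r"
  shows "\<exists>i\<le>n. nesting r i i"
  using assms(4)
proof
  assume "card {x \<in> S. x < \<tau> x} \<ge> r"
  then show ?thesis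
    by (rule nesting_if_openers[rotated 3]) (use assms in \<open>auto intro: monotone_on_subset\<close>)
next
  assume "card (\<tau> ` {x \<in> S. \<tau> x < x}) \<ge> r"
  moreover have "\<tau> ` {x \<in> S. \<tau> x < x} \<subseteq> {1..n}"
    using assms(1) tau_le tau_pos by (force simp: Suc_le_eq)
  moreover have "strict_antimono_on {x \<in> S. \<tau> x < x} \<tau>" using assms(2) by (rule monotone_on_subset) auto
  ultimately show ?thesis
    by (intro nesting_if_openers[of "\<tau> ` {x \<in> S. \<tau> x < x}"] antimono_image) (use assms(3) in auto)
qed

text \<open>Pigeonhole: with at most one fixed point, \<open>2 * l + 2\<close> entries include
  \<open>l + 1\<close> openers or \<open>l + 1\<close> closers.\<close>

lemma descending_even_iff:
  "has_descending_subsequence (2 * l + 2) (n, \<tau>) \<longleftrightarrow> (\<exists>i\<le>n. nesting (Suc l) i i)"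
proof
  assume "has_descending_subsequence (2 * l + 2) (n, \<tau>)"
  then obtain S where S: "card S = 2 * l + 2" "S \<subseteq> {1..n}" "strict_antimono_on S \<tau>"
    unfolding has_descending_iff by blast
  then have "card {x \<in> S. x < \<tau> x} \<ge> Suc l \<or> card (\<tau> ` {x \<in> S. \<tau> x < x}) \<ge> Suc l"
    using descending_parts[OF S] by auto
  then show "\<exists>i\<le>n. nesting (Suc l) i i" using descending_openers[OF S(2,3)] by blast
next
  assume "\<exists>i\<le>n. nesting (Suc l) i i"
  then obtain i S where S: "i \<le> n" "card S = Suc l" "S \<subseteq> {1..i}" "\<tau> ` S \<subseteq> {i<..n}" "strict_antimono_on S \<tau>"
    unfolding nesting_def by blast
  have "S \<union> \<tau> ` S \<subseteq> {1..n}" using S by force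
  then show "has_descending_subsequence (2 * l + 2) (n, \<tau>)"
    unfolding has_descending_iff using antimono_union_image[OF S(3,4) _ S(5)] S(2)
    by (intro exI[of _ "S \<union> \<tau> ` S"]) auto
qed

text \<open>If neither openers nor closers reach \<open>l + 1\<close>, there are \<open>l\<close> of
  each and one fixed point, which the arcs of these openers must surround.\<close>

lemma descending_odd_iff:
  "has_descending_subsequence (2 * l + 1) (n, \<tau>) \<longleftrightarrow>
     (\<exists>i\<le>n. nesting (Suc l) i i) \<or> (\<exists>i<n. \<tau> (Suc i) = Suc i \<and> nesting l i (Suc i))"
proof
  assume "has_descending_subsequence (2 * l + 1) (n, \<tau>)"
  then obtain S where S: "card S = 2 * l + 1" "S \<subseteq> {1..n}" "strict_antimono_on S \<tau>"
    unfolding has_descending_iff by blast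
  let ?A = "{x \<in> S. x < \<tau> x}"
  show "(\<exists>i\<le>n. nesting (Suc l) i i) \<or> (\<exists>i<n. \<tau> (Suc i) = Suc i \<and> nesting l i (Suc i))"
  proof (cases "card ?A \<ge> Suc l \<or> card (\<tau> ` {x \<in> S. \<tau> x < x}) \<ge> Suc l")
    case True
    then show ?thesis using descending_openers[OF S(2,3)] by blast
  next
    case False
    then have A: "card ?A = l" and "card {x \<in> S. \<tau> x = x} = 1"
      using descending_parts[OF S] by auto
    then obtain f where "{x \<in> S. \<tau> x = x} = {f}" using card_1_singletonE by blast
    then have f: "f \<in> S" "\<tau> f = f" by auto
    then obtain i where i: "f = Suc i" "i < n" using S(2) by (cases f) force+
    \<comment> \<open>An opener after \<open>f\<close> would have a partner above \<open>f\<close>,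
      against the descent.\<close>
    have "x < f \<and> \<tau> x > f" if "x \<in> ?A" for x
    proof -
      have "x \<noteq> f" using that f by auto
      moreover have "\<not> f < x" using monotone_onD[OF S(3), of f x] f that by auto
      ultimately have "x < f" by simp
      then show ?thesis using monotone_onD[OF S(3), of x f] f that by auto
    qed
    then have "?A \<subseteq> {1..i}" "\<tau> ` ?A \<subseteq> {Suc i<..n}" using S(2) i tau_le by force+
    moreover have "strict_antimono_on ?A \<tau>" using S(3) by (rule monotone_on_subset) auto
    ultimately have "nesting l i (Suc i)" unfolding nesting_def using A by blast
    then show ?thesis using f i by blast
  qed
next
  assume "(\<exists>i\<le>n. nesting (Suc l) i i) \<or> (\<exists>i<n. \<tau> (Suc i) = Suc i \<and> nesting l i (Suc i))"
  then show "has_descending_subsequence (2 * l + 1) (n, \<tau>)"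
  proof
    assume "\<exists>i\<le>n. nesting (Suc l) i i"
    then obtain S where S: "card S = 2 * l + 2" "S \<subseteq> {1..n}" "strict_antimono_on S \<tau>"
      using descending_even_iff[of l] unfolding has_descending_iff by blast
    obtain T where T: "T \<subseteq> S" "card T = 2 * l + 1" using obtain_subset_with_card_n[of "2 * l + 1" S] S(1) by auto
    then have "T \<subseteq> {1..n}" "strict_antimono_on T \<tau>" using S(2) monotone_on_subset[OF S(3)] by auto
    then show ?thesis unfolding has_descending_iff using T(2) by blast
  next
    assume "\<exists>i<n. \<tau> (Suc i) = Suc i \<and> nesting l i (Suc i)"
    then obtain i S where S: "i < n" "\<tau> (Suc i) = Suc i" "card S = l" "S \<subseteq> {1..i}" "\<tau> ` S \<subseteq> {Suc i<..n}"
      "strict_antimono_on S \<tau>"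
      unfolding nesting_def by blast
    let ?T = "S \<union> \<tau> ` S"
    have T: "strict_antimono_on ?T \<tau>" "card ?T = 2 * l" using antimono_union_image[OF S(4,5) _ S(6)] S(3) by auto
    have "finite S" using S(4) finite_subset by blast
    moreover have "Suc i \<notin> ?T" using S(4,5) by force
    ultimately have "card (insert (Suc i) ?T) = 2 * l + 1" using T by simp
    moreover have "insert (Suc i) ?T \<subseteq> {1..n}" using S by force
    moreover have "strict_antimono_on (insert (Suc i) ?T) \<tau>"
    proof (rule monotone_onI)
      fix x y assume xy: "x \<in> insert (Suc i) ?T" "y \<in> insert (Suc i) ?T" "x < y"
      have low: "z \<in> S \<and> \<tau> z > Suc i" if "z \<in> ?T" "z < Suc i" for z using that S(5) by force
      have high: "\<tau> z < Suc i" if "z \<in> ?T" "z > Suc i" for z using that S(4) by force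
      consider "x \<in> ?T" "y \<in> ?T" | "x = Suc i" "y \<in> ?T" | "x \<in> ?T" "y = Suc i" using xy by auto
      then show "\<tau> x > \<tau> y"
      proof cases
        case 1 then show ?thesis using xy monotone_onD[OF T(1)] by blast
      next
        case 2 then show ?thesis using high[of y] xy(3) S(2) by simp
      next
        case 3 then show ?thesis using low[of x] xy(3) S(2) by simp
      qed
    qed
    ultimately show ?thesis unfolding has_descending_iff by blast
  qed
qed

end

section \<open>Involutions as closed walks\<close>

lemma covers_le: "covers v w \<Longrightarrow> v \<le> w"
  by (auto simp: covers_def dest: cover_row_le)

lemma covers_neq: "covers v w \<Longrightarrow> v \<noteq> w"
  by (auto simp: covers_def dest: cover_row_neq)

lemma covers_asym: "covers v w \<Longrightarrow> \<not> covers w v"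
  using covers_le covers_neq by (metis order_antisym)

lemma covers_shape: "covers v w \<Longrightarrow> shape v \<and> shape w"
  by (auto simp: covers_def dest: cover_row_shape)

lemma step_zero: "step v (\<lambda>_. 0) \<Longrightarrow> v = (\<lambda>_. 0)"
  by (auto simp: le_fun_def fun_eq_iff dest!: covers_le)

text \<open>The condition \<open>w l = 0\<close> bounds the number of columns by \<open>l\<close>;
  the two parities of \<open>m\<close> differ only in \<open>stay\<close>.\<close>

definition nbrs :: "((nat \<Rightarrow> nat) \<Rightarrow> bool) \<Rightarrow> nat \<Rightarrow> (nat \<Rightarrow> nat) \<Rightarrow> (nat \<Rightarrow> nat) set" where
  "nbrs stay l v = {w. shape w \<and> w l = 0 \<and> (covers v w \<or> covers w v \<or> w = v \<and> stay v)}"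

text \<open>Padding with the empty shape from time \<open>n\<close> on makes a walk a total function
  determined by its \<open>n\<close> steps, and it also fixes the end point.\<close>

definition walks :: "((nat \<Rightarrow> nat) \<Rightarrow> bool) \<Rightarrow> nat \<Rightarrow> nat \<Rightarrow> (nat \<Rightarrow> nat) \<Rightarrow> (nat \<Rightarrow> nat \<Rightarrow> nat) set" where
  "walks stay l n v = {s. s 0 = v \<and> (\<forall>i\<ge>n. s i = (\<lambda>_. 0)) \<and> (\<forall>i<n. s (Suc i) \<in> nbrs stay l (s i))}"

definition smaller :: "(nat \<Rightarrow> nat) \<Rightarrow> (nat \<Rightarrow> nat) \<Rightarrow> nat \<Rightarrow> nat" where
  "smaller v w = (if covers w v then w else v)"

text \<open>Runs the rules backwards from the diagonal and the line next to it, by induction on the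
  distance; the flags, and so the arcs, come out as well.\<close>

lemma growth_unique:
  assumes "growth \<tau> g" "growth \<tau>' g'"
    and "\<And>i. g i i = g' i i" "\<And>i. g i (Suc i) = g' i (Suc i)"
  shows "g a (a + d) = g' a (a + d)"
    and "p < q \<Longrightarrow> \<tau> (Suc p) = Suc q \<longleftrightarrow> \<tau>' (Suc p) = Suc q"
proof -
  have eq: "g a (a + d) = g' a (a + d)" for a d
  proof (induction d arbitrary: a rule: less_induct)
    case (less d)
    consider "d = 0" | "d = 1" | e where "d = Suc (Suc e)" by (metis One_nat_def old.nat.exhaust)
    then show ?case
    proof cases
      case (3 e)
      have "local_rule (\<tau> (Suc a) = Suc (Suc (a + e))) (g a (a + d)) (g (Suc a) (Suc a + Suc e)) (g a (a + Suc e)) (g (Suc a) (Suc a + e))"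
        using assms(1)[unfolded growth_def, rule_format, of a "Suc (a + e)"] 3 by simp
      moreover have "local_rule (\<tau>' (Suc a) = Suc (Suc (a + e))) (g' a (a + d)) (g' (Suc a) (Suc a + Suc e)) (g' a (a + Suc e)) (g' (Suc a) (Suc a + e))"
        using assms(2)[unfolded growth_def, rule_format, of a "Suc (a + e)"] 3 by simp
      ultimately show ?thesis
        using less.IH[of e "Suc a"] less.IH[of "Suc e" "Suc a"] less.IH[of "Suc e" a] 3
        by (auto dest: local_rule_backward_unique)
    qed (use assms(3,4) in auto)
  qed
  show "g a (a + d) = g' a (a + d)" by (rule eq)
  have eq': "g a b = g' a b" if "a \<le> b" for a b using eq[of a "b - a"] that by simp
  assume "p < q"
  then have "local_rule (\<tau> (Suc p) = Suc q) (g p (Suc q)) (g (Suc p) (Suc q)) (g p q) (g (Suc p) q)"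
    "local_rule (\<tau>' (Suc p) = Suc q) (g p (Suc q)) (g (Suc p) (Suc q)) (g p q) (g (Suc p) q)"
    using assms(1,2) eq' by (auto simp: growth_def)
  then show "\<tau> (Suc p) = Suc q \<longleftrightarrow> \<tau>' (Suc p) = Suc q" using local_rule_backward_unique by blast
qed

text \<open>Runs the rules forwards from the empty boundary; this will identify a diagram rebuilt
  from a walk with \<open>g\<close>.\<close>

lemma growth_boundary_unique:
  assumes "growth \<tau> g" "growth \<tau> g'"
    and "\<And>b. g 0 b = (\<lambda>_. 0)" "\<And>b. g' 0 b = (\<lambda>_. 0)"
    and "\<And>a b. n \<le> b \<Longrightarrow> a \<le> b \<Longrightarrow> g a b = (\<lambda>_. 0)" "\<And>a b. n \<le> b \<Longrightarrow> a \<le> b \<Longrightarrow> g' a b = (\<lambda>_. 0)"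
    and "a \<le> b"
  shows "g a b = g' a b"
  using \<open>a \<le> b\<close>
proof (induction a arbitrary: b)
  case 0
  then show ?case using assms by simp
next
  case (Suc a)
  have col: "g (Suc a) b = g' (Suc a) b" if "k = n - b" "Suc a \<le> b" for k b
    using that
  proof (induction k arbitrary: b)
    case 0
    then show ?case using assms(5,6) by simp
  next
    case (Suc k)
    have "local_rule (\<tau> (Suc a) = Suc b) (g a (Suc b)) (g (Suc a) (Suc b)) (g a b) (g (Suc a) b)"
      "local_rule (\<tau> (Suc a) = Suc b) (g' a (Suc b)) (g' (Suc a) (Suc b)) (g' a b) (g' (Suc a) b)"
      using assms(1,2) Suc.prems unfolding growth_def by auto
    moreover have "g (Suc a) (Suc b) = g' (Suc a) (Suc b)" using Suc by auto
    moreover have "g a b = g' a b" "g a (Suc b) = g' a (Suc b)"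
      using \<open>\<And>b. a \<le> b \<Longrightarrow> g a b = g' a b\<close> Suc.prems by auto
    ultimately show ?case using local_rule_forward_unique by metis
  qed
  show ?case using col Suc.prems by blast
qed

context involution
begin

lemma g_zero_left: "g 0 b = (\<lambda>_. 0)"
  by (simp add: g_def)

lemma g_zero_right: "n \<le> b \<Longrightarrow> g a b = (\<lambda>_. 0)"
  by (simp add: g_def grow_0)

lemma g_smaller: "g i (Suc i) = smaller (g i i) (g (Suc i) (Suc i))"
proof (cases "i < n")
  case True
  note col = g_step_col[OF True] and row = g_step_row[OF True]
  show ?thesis
  proof (cases "\<tau> (Suc i) \<le> i")
    case True
    then show ?thesis using col row unfolding smaller_def by force
  next
    case False
    then have "g i (Suc i) = g i i" using row(2) by blast
    then show ?thesis using col(1) covers_asym covers_neq unfolding smaller_def by metis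
  qed
next
  case False
  then show ?thesis by (simp add: g_zero_right smaller_def)
qed

text \<open>By \<open>g_nesting\<close> the column bound forbids \<open>l + 1\<close> nested arcs.
  The walk stays exactly at fixed points, where \<open>g i (Suc i)\<close> equals
  \<open>g i i\<close>.\<close>

lemma diagonal_in_walks_iff:
  "(\<lambda>i. g i i) \<in> walks stay l n (\<lambda>_. 0) \<longleftrightarrow>
     (\<forall>i\<le>n. \<not> nesting (Suc l) i i) \<and> (\<forall>i<n. \<tau> (Suc i) = Suc i \<longrightarrow> stay (g i (Suc i)))"
proof -
  have nest: "g (Suc i) (Suc i) l = 0 \<longleftrightarrow> \<not> nesting (Suc l) (Suc i) (Suc i)" if "i < n" for i
    using g_nesting[of "Suc i" "Suc i" l] that by auto
  have "g (Suc i) (Suc i) \<in> nbrs stay l (g i i) \<longleftrightarrow>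
      \<not> nesting (Suc l) (Suc i) (Suc i) \<and> (\<tau> (Suc i) = Suc i \<longrightarrow> stay (g i (Suc i)))" if "i < n" for i
  proof -
    note col = g_step_col[OF that] and row = g_step_row[OF that]
    consider "\<tau> (Suc i) \<le> i" | "Suc i < \<tau> (Suc i)" | "\<tau> (Suc i) = Suc i" by linarith
    then show ?thesis
    proof cases
      case 1
      then show ?thesis using col row nest[OF that] by (auto simp: nbrs_def)
    next
      case 2
      then show ?thesis using col row nest[OF that] by (auto simp: nbrs_def)
    next
      case 3
      then have "g i i = g (Suc i) (Suc i)" "g i (Suc i) = g i i" using col row by auto
      then show ?thesis using 3 col nest[OF that] covers_neq by (auto simp: nbrs_def)
    qed
  qed
  moreover have "(\<forall>i\<le>n. \<not> nesting (Suc l) i i) \<longleftrightarrow> (\<forall>i<n. \<not> nesting (Suc l) (Suc i) (Suc i))"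
    by (metis Suc_leI less_Suc_eq_le nesting_left_0 not0_implies_Suc Suc_less_eq)
  ultimately show ?thesis by (auto simp: walks_def g_zero_left g_zero_right)
qed

end

text \<open>By \<open>g_smaller\<close> the diagonal determines the line next to it, so backward
  uniqueness recovers all arcs; points on no arc are fixed.\<close>

lemma diagonal_inj:
  assumes "involution n \<tau>" "involution n \<tau>'" "(\<lambda>i. involution.g n \<tau> i i) = (\<lambda>i. involution.g n \<tau>' i i)"
  shows "\<tau> = \<tau>'"
proof -
  interpret A: involution n \<tau> by fact
  interpret B: involution n \<tau>' by fact
  have diag: "A.g i i = B.g i i" for i using assms(3) by meson
  have arcs: "\<tau> p = q \<longleftrightarrow> \<tau>' p = q" if "0 < p" "p < q" for p q
    using growth_unique(2)[OF A.growth_g B.growth_g diag, of "p - 1" "q - 1"] that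
    by (auto simp: A.g_smaller B.g_smaller diag)
  have "\<tau> p = \<tau>' p" for p
  proof (cases "p = 0")
    case True
    then show ?thesis using permutes_not_in[OF A.permutes, of 0] permutes_not_in[OF B.permutes, of 0] by simp
  next
    case False
    then have "\<tau> p > 0" "\<tau>' p > 0" using A.tau_pos B.tau_pos by auto
    then show ?thesis using False arcs[of p "\<tau> p"] arcs[of p "\<tau>' p"] arcs[of "\<tau> p" p] arcs[of "\<tau>' p" p]
      A.tau_tau[of p] B.tau_tau[of p] B.tau_tau A.tau_tau by (metis gr0I nat_neq_iff)
  qed
  then show ?thesis by blast
qed

section \<open>The inverse map: from a closed walk to an involution\<close>

text \<open>\<open>ungrow s d a\<close> is the shape at \<open>(a, a + d)\<close>, computed from the diagonal outwards.\<close>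
fun ungrow :: "(nat \<Rightarrow> nat \<Rightarrow> nat) \<Rightarrow> nat \<Rightarrow> nat \<Rightarrow> nat \<Rightarrow> nat" where
  "ungrow s 0 a = s a"
| "ungrow s (Suc 0) a = smaller (s a) (s (Suc a))"
| "ungrow s (Suc (Suc d)) a =
     (SOME v. \<exists>x. local_rule x v (ungrow s (Suc d) (Suc a)) (ungrow s (Suc d) a) (ungrow s d (Suc a)))"

declare ungrow.simps(3) [simp del]

locale closed_walk =
  fixes n :: nat and s :: "nat \<Rightarrow> nat \<Rightarrow> nat"
  assumes start: "s 0 = (\<lambda>_. 0)" and finish: "n \<le> i \<Longrightarrow> s i = (\<lambda>_. 0)"
    and adjacent: "shape (s i)" "s i = s (Suc i) \<or> covers (s i) (s (Suc i)) \<or> covers (s (Suc i)) (s i)"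
begin

text \<open>Backward existence keeps every edge a step, which is what the next choice in
  \<open>ungrow\<close> requires.\<close>

lemma ungrow_step: "step (ungrow s (Suc d) a) (ungrow s d a) \<and> step (ungrow s (Suc d) a) (ungrow s d (Suc a))"
  and ungrow_rule: "\<exists>x. local_rule x (ungrow s (Suc (Suc d)) a) (ungrow s (Suc d) (Suc a)) (ungrow s (Suc d) a) (ungrow s d (Suc a))"
proof -
  let ?S = "\<lambda>d a. step (ungrow s (Suc d) a) (ungrow s d a) \<and> step (ungrow s (Suc d) a) (ungrow s d (Suc a))"
  let ?L = "\<lambda>d a. \<exists>x. local_rule x (ungrow s (Suc (Suc d)) a) (ungrow s (Suc d) (Suc a)) (ungrow s (Suc d) a) (ungrow s d (Suc a))"
  have L: "?L d a" if "\<And>a. ?S d a" for d a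
  proof -
    have "\<exists>v x. local_rule x v (ungrow s (Suc d) (Suc a)) (ungrow s (Suc d) a) (ungrow s d (Suc a))"
      using local_rule_backward that by meson
    then show ?thesis unfolding ungrow.simps(3) by (rule someI_ex)
  qed
  have S: "?S d a" for d a
  proof (induction d arbitrary: a)
    case 0
    show ?case using adjacent[of a] adjacent(1)[of "Suc a"] by (auto simp: smaller_def)
  next
    case (Suc d)
    show ?case using L[OF Suc.IH, of a] local_rule_step by meson
  qed
  show "?S d a" by (rule S)
  show "?L d a" by (rule L) (rule S)
qed

definition h :: "nat \<Rightarrow> nat \<Rightarrow> nat \<Rightarrow> nat" where
  "h a b = ungrow s (b - a) a"

text \<open>Cells are counted from 0, so \<open>arc a b\<close> stands for an arc from
  \<open>Suc a\<close> to \<open>Suc b\<close>.\<close>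

definition arc :: "nat \<Rightarrow> nat \<Rightarrow> bool" where
  "arc a b \<longleftrightarrow> a < b \<and> local_rule True (h a (Suc b)) (h (Suc a) (Suc b)) (h a b) (h (Suc a) b)"

lemma h_rule:
  assumes "a < b" shows "local_rule (arc a b) (h a (Suc b)) (h (Suc a) (Suc b)) (h a b) (h (Suc a) b)"
proof -
  obtain e where e: "b = Suc (a + e)" using assms less_iff_Suc_add by auto
  then have "\<exists>x. local_rule x (h a (Suc b)) (h (Suc a) (Suc b)) (h a b) (h (Suc a) b)"
    using ungrow_rule[of e a] by (simp add: h_def Suc_diff_le)
  then show ?thesis using assms unfolding arc_def by (metis (full_types))
qed

text \<open>Shapes can only shrink away from the diagonal, so the empty shape at the start of the
  walk spreads along this boundary.\<close>

lemma h_zero_left: "h 0 b = (\<lambda>_. 0)"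
proof -
  have "ungrow s d 0 = (\<lambda>_. 0)" for d
    by (induction d) (use start ungrow_step step_zero in \<open>metis ungrow.simps(1)\<close>)+
  then show ?thesis by (simp add: h_def)
qed

lemma h_zero_right:
  assumes "n \<le> b" "a \<le> b" shows "h a b = (\<lambda>_. 0)"
proof -
  have "n \<le> a + d \<Longrightarrow> ungrow s d a = (\<lambda>_. 0)" for d a
  proof (induction d arbitrary: a)
    case 0 then show ?case using finish by simp
  next
    case (Suc d)
    then have "ungrow s d (Suc a) = (\<lambda>_. 0)" by simp
    then show ?case using ungrow_step[of d a] step_zero by metis
  qed
  then show ?thesis using assms by (simp add: h_def)
qed

lemma h_diag: "h i i = s i" "h i (Suc i) = smaller (s i) (s (Suc i))"
  by (simp_all add: h_def)

lemma h_change: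
  assumes "a < b"
  shows "h a b \<noteq> h (Suc a) b \<longleftrightarrow> arc a b \<or> h a (Suc b) \<noteq> h (Suc a) (Suc b)"
    and "h (Suc a) (Suc b) \<noteq> h (Suc a) b \<longleftrightarrow> arc a b \<or> h a (Suc b) \<noteq> h a b"
    and "arc a b \<Longrightarrow> h a (Suc b) = h (Suc a) (Suc b) \<and> h a (Suc b) = h a b"
  using local_rule_change[OF h_rule[OF assms]] by metis+

text \<open>On the way towards the diagonal an arc can start a nontrivial edge, but no cell ends
  one.\<close>

lemma col_mono:
  assumes "a < b" "b \<le> c" "h a c \<noteq> h (Suc a) c" shows "h a b \<noteq> h (Suc a) b"
  using assms(2,3)
proof (induction c rule: dec_induct)
  case (step c)
  then have "a < c" using assms(1) by simp
  then show ?case using step h_change(1)[of a c] by blast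
qed

lemma row_mono: "a \<le> c \<Longrightarrow> c \<le> b \<Longrightarrow> h a (Suc b) \<noteq> h a b \<Longrightarrow> h c (Suc b) \<noteq> h c b"
  by (induction c rule: dec_induct) (use h_change(2) Suc_le_lessD in auto)

text \<open>The edge started by the farther of two arcs would reach the nearer cell, whose arc
  demands trivial edges there.\<close>

lemma arc_left_unique: assumes "arc a b" "arc a c" shows "b = c"
proof -
  have "\<not> b < c" if "arc a b" "arc a c" for b c
  proof
    assume "b < c"
    have "a < b" "a < c" using that by (auto simp: arc_def)
    then have "h a c \<noteq> h (Suc a) c" using h_change(1) that by blast
    then have "h a (Suc b) \<noteq> h (Suc a) (Suc b)" using col_mono[of a "Suc b" c] \<open>a < b\<close> \<open>b < c\<close> by auto
    then show False using h_change(3)[OF \<open>a < b\<close>] that by blast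
  qed
  then show ?thesis using assms by (meson nat_neq_iff)
qed

lemma arc_right_unique: assumes "arc a c" "arc b c" shows "a = b"
proof -
  have "\<not> a < b" if "arc a c" "arc b c" for a b
  proof
    assume "a < b"
    have "a < c" "b < c" using that by (auto simp: arc_def)
    then have "h (Suc a) (Suc c) \<noteq> h (Suc a) c" using h_change(2) that by blast
    then have "h b (Suc c) \<noteq> h b c" using row_mono[of "Suc a" b c] \<open>b < c\<close> \<open>a < b\<close> by auto
    then show False using h_change(3)[OF \<open>b < c\<close>] that by metis
  qed
  then show ?thesis using assms by (meson nat_neq_iff)
qed

text \<open>A point that both closes and opens would make \<open>h b (Suc b)\<close> differ from
  both diagonal neighbours, yet by construction it equals one of them.\<close>

lemma arc_disjoint: assumes "arc a b" shows "\<not> arc b c"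
proof
  assume "arc b c"
  then have bc: "b < c" by (simp add: arc_def)
  then have "h b c \<noteq> h (Suc b) c" using h_change(1)[OF bc] \<open>arc b c\<close> by blast
  with bc have 1: "h b (Suc b) \<noteq> h (Suc b) (Suc b)" using col_mono[of b "Suc b" c] by auto
  have ab: "a < b" using assms by (simp add: arc_def)
  then have "h (Suc a) (Suc b) \<noteq> h (Suc a) b" using h_change(2)[OF ab] assms by blast
  with ab have "h b (Suc b) \<noteq> h b b" using row_mono[of "Suc a" b b] by auto
  with 1 show False by (auto simp: h_diag smaller_def split: if_splits)
qed

lemma arc_less: assumes "arc a b" shows "a < b \<and> b < n"
proof -
  have ab: "a < b" using assms by (simp add: arc_def)
  then have "h a b \<noteq> h (Suc a) b" using h_change(1)[OF ab] assms by blast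
  then have "\<not> n \<le> b" using h_zero_right[of b a] h_zero_right[of b "Suc a"] ab by auto
  with ab show ?thesis by simp
qed

definition partner :: "nat \<Rightarrow> nat \<Rightarrow> bool" where
  "partner p q \<longleftrightarrow> (\<exists>a b. arc a b \<and> (p = Suc a \<and> q = Suc b \<or> p = Suc b \<and> q = Suc a))"

definition sigma :: "nat \<Rightarrow> nat" where
  "sigma p = (if \<exists>q. partner p q then SOME q. partner p q else p)"

lemma partner_unique: "partner p q \<Longrightarrow> partner p r \<Longrightarrow> q = r"
  unfolding partner_def using arc_left_unique arc_right_unique arc_disjoint by (metis nat.inject)

lemma sigma_partner: "partner p q \<Longrightarrow> sigma p = q"
  unfolding sigma_def using partner_unique by (metis someI)

lemma partner_sym: "partner p q \<Longrightarrow> partner q p"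
  unfolding partner_def by blast

lemma sigma_sigma: "sigma (sigma p) = p"
proof (cases "\<exists>q. partner p q")
  case True
  then show ?thesis using sigma_partner partner_sym by metis
next
  case False
  then show ?thesis by (simp add: sigma_def)
qed

lemma sigma_arc: "a < b \<Longrightarrow> sigma (Suc a) = Suc b \<longleftrightarrow> arc a b"
proof
  assume "a < b" "sigma (Suc a) = Suc b"
  then have "partner (Suc a) (Suc b)" using sigma_partner unfolding sigma_def by (metis less_not_refl2 nat.inject)
  then show "arc a b" using \<open>a < b\<close> arc_less unfolding partner_def by (metis nat.inject less_asym)
next
  assume "arc a b"
  then show "sigma (Suc a) = Suc b" using sigma_partner unfolding partner_def by blast
qed

lemma sigma_involution: "involution n sigma"
proof
  have "sigma p = p" if "p \<notin> {1..n}" for p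
  proof -
    have "\<not> partner p q" for q using that arc_less unfolding partner_def by fastforce
    then show ?thesis by (simp add: sigma_def)
  qed
  then show "sigma permutes {1..n}" unfolding permutes_def using sigma_sigma by metis
  show "sigma \<circ> sigma = id" using sigma_sigma by auto
qed

lemma sigma_growth: "growth sigma h"
  unfolding growth_def using h_rule by (simp add: sigma_arc)

text \<open>The rebuilt diagram \<open>h\<close> and the one grown from \<open>sigma\<close> obey
  the same rules with the same empty boundary, so they agree and the walk is recovered.\<close>

lemma sigma_diagonal: "involution.g n sigma i i = s i"
proof -
  interpret A: involution n sigma by (rule sigma_involution)
  have "A.g i i = h i i"
    using growth_boundary_unique[OF A.growth_g sigma_growth A.g_zero_left h_zero_left, of n i i]
      A.g_zero_right h_zero_right by blast
  then show ?thesis by (simp add: h_diag)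
qed

end

lemma walks_closed_walk:
  assumes "s \<in> walks stay l n (\<lambda>_. 0)" shows "closed_walk n s"
proof
  show s0: "s 0 = (\<lambda>_. 0)" and sn: "n \<le> i \<Longrightarrow> s i = (\<lambda>_. 0)" for i
    using assms by (auto simp: walks_def)
  show "shape (s i)" for i
  proof (cases "i \<in> {1..n}")
    case True
    then obtain k where "i = Suc k" "k < n" by (cases i) auto
    then show ?thesis using assms by (auto simp: walks_def nbrs_def)
  next
    case False
    then have "s i = (\<lambda>_. 0)" using s0 sn[of i] by (cases i) auto
    then show ?thesis by simp
  qed
  show "s i = s (Suc i) \<or> covers (s i) (s (Suc i)) \<or> covers (s (Suc i)) (s i)" for i
    using assms sn[of i] sn[of "Suc i"] by (cases "i < n") (auto simp: walks_def nbrs_def)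
qed

text \<open>The abstract \<open>P\<close> serves both parities. Injectivity is
  \<open>diagonal_inj\<close>, surjectivity the construction of \<open>sigma\<close>.\<close>

theorem card_involutions_eq_card_walks:
  assumes "\<And>\<tau>. involution n \<tau> \<Longrightarrow> P \<tau> \<longleftrightarrow> (\<lambda>i. involution.g n \<tau> i i) \<in> walks stay l n (\<lambda>_. 0)"
  shows "card {\<tau>. involution n \<tau> \<and> P \<tau>} = card (walks stay l n (\<lambda>_. 0))"
proof (rule bij_betw_same_card)
  show "bij_betw (\<lambda>\<tau> i. involution.g n \<tau> i i) {\<tau>. involution n \<tau> \<and> P \<tau>} (walks stay l n (\<lambda>_. 0))"
  proof (rule bij_betw_imageI)
    show "inj_on (\<lambda>\<tau> i. involution.g n \<tau> i i) {\<tau>. involution n \<tau> \<and> P \<tau>}"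
      by (intro inj_onI diagonal_inj) auto
    show "(\<lambda>\<tau> i. involution.g n \<tau> i i) ` {\<tau>. involution n \<tau> \<and> P \<tau>} = walks stay l n (\<lambda>_. 0)"
    proof (intro equalityI subsetI)
      fix s assume s: "s \<in> walks stay l n (\<lambda>_. 0)"
      then interpret closed_walk n s by (rule walks_closed_walk)
      have "(\<lambda>i. involution.g n sigma i i) = s" using sigma_diagonal by blast
      then show "s \<in> (\<lambda>\<tau> i. involution.g n \<tau> i i) ` {\<tau>. involution n \<tau> \<and> P \<tau>}"
        using s sigma_involution assms by (intro image_eqI[of _ _ sigma]) auto
    qed (use assms in auto)
  qed
qed

lemma card_no_descending_odd:
  "card {\<tau>. involution n \<tau> \<and> \<not> has_descending_subsequence (2 * l + 2) (n, \<tau>)} =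
     card (walks (\<lambda>_. True) l n (\<lambda>_. 0))"
  by (rule card_involutions_eq_card_walks)
    (simp only: involution.descending_even_iff involution.diagonal_in_walks_iff simp_thms not_ex not_all de_Morgan_conj imp_conv_disj)

text \<open>The stay condition says that there are fewer than \<open>l\<close> columns; at a fixed
  point this excludes \<open>l\<close> nested arcs around it.\<close>

lemma card_no_descending_even:
  assumes "l > 0"
  shows "card {\<tau>. involution n \<tau> \<and> \<not> has_descending_subsequence (2 * l + 1) (n, \<tau>)} =
     card (walks (\<lambda>v. v (l - 1) = 0) l n (\<lambda>_. 0))"
proof (rule card_involutions_eq_card_walks)
  fix \<tau> assume "involution n \<tau>"
  then interpret involution n \<tau> .
  have "g i (Suc i) (l - 1) = 0 \<longleftrightarrow> \<not> nesting l i (Suc i)" if "i < n" for i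
    using g_nesting[of "Suc i" i "l - 1"] assms that by auto
  then show "\<not> has_descending_subsequence (2 * l + 1) (n, \<tau>) \<longleftrightarrow>
      (\<lambda>i. g i i) \<in> walks (\<lambda>v. v (l - 1) = 0) l n (\<lambda>_. 0)"
    unfolding descending_odd_iff diagonal_in_walks_iff by auto
qed

section \<open>Counting walks by determinants\<close>

lemma shape_upd_Suc_covers_iff:
  assumes "shape v" shows "shape (v(j := Suc (v j))) \<longleftrightarrow> covers v (v(j := Suc (v j)))"
proof
  assume a: "shape (v(j := Suc (v j)))"
  have "v i > v j" if "i < j" for i using shape_antimono[OF a, of i j] that by simp
  then show "covers v (v(j := Suc (v j)))" using assms unfolding covers_def cover_row_def by blast
qed (use covers_shape in blast)

lemma up_nbrs:
  assumes "shape v" "v l = 0"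
  shows "{w. shape w \<and> w l = 0 \<and> covers v w} = (\<lambda>j. v(j := Suc (v j))) ` {j. j < l \<and> shape (v(j := Suc (v j)))}"
proof (intro equalityI subsetI)
  fix w assume "w \<in> {w. shape w \<and> w l = 0 \<and> covers v w}"
  then have w: "shape w" "w l = 0" "covers v w" by auto
  then obtain j where j: "\<forall>i<j. v i > v j" "w = v(j := Suc (v j))" by (auto simp: covers_def cover_row_def)
  have "j \<noteq> l" using w(2) j by auto
  \<comment> \<open>Column \<open>l\<close> is already empty, so no later column is the first of its
    height.\<close>
  moreover have "\<not> l < j" using j(1) assms(2) by auto
  ultimately show "w \<in> (\<lambda>j. v(j := Suc (v j))) ` {j. j < l \<and> shape (v(j := Suc (v j)))}"
    using j(2) w(1) by auto
qed (use assms shape_upd_Suc_covers_iff in auto)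

lemma down_nbrs:
  assumes "shape v" "v l = 0"
  shows "{w. shape w \<and> w l = 0 \<and> covers w v} = (\<lambda>j. v(j := v j - 1)) ` {j. j < l \<and> v j > 0 \<and> shape (v(j := v j - 1))}"
proof (intro equalityI subsetI)
  fix w assume "w \<in> {w. shape w \<and> w l = 0 \<and> covers w v}"
  then have w: "shape w" "w l = 0" "covers w v" by auto
  then obtain j where j: "v = w(j := Suc (w j))" by (auto simp: covers_def cover_row_def)
  have "v j > 0" using j by (metis fun_upd_same zero_less_Suc)
  then have "\<not> l \<le> j" using shape_antimono[OF assms(1), of l j] assms(2) by auto
  moreover have "w = v(j := v j - 1)" using j by (auto simp: fun_eq_iff)
  ultimately show "w \<in> (\<lambda>j. v(j := v j - 1)) ` {j. j < l \<and> v j > 0 \<and> shape (v(j := v j - 1))}"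
    using w(1) \<open>v j > 0\<close> by auto
next
  fix w assume "w \<in> (\<lambda>j. v(j := v j - 1)) ` {j. j < l \<and> v j > 0 \<and> shape (v(j := v j - 1))}"
  then obtain j where j: "w = v(j := v j - 1)" "j < l" "v j > 0" "shape w" by auto
  have "v = w(j := Suc (w j))" using j by (auto simp: fun_eq_iff)
  moreover have "covers w (w(j := Suc (w j)))"
    using shape_upd_Suc_covers_iff[OF j(4), of j] calculation assms(1) by simp
  ultimately show "w \<in> {w. shape w \<and> w l = 0 \<and> covers w v}" using j assms(2) by auto
qed

text \<open>Rewrites the sum over neighbours as a sum over columns with illegal moves counted as 0,
  the form in which a differentiated determinant appears.\<close>

lemma sum_nbrs:
  fixes f :: "(nat \<Rightarrow> nat) \<Rightarrow> 'a :: comm_monoid_add"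
  assumes "shape v" "v l = 0"
  shows "finite (nbrs stay l v)"
    and "(\<Sum>w\<in>nbrs stay l v. f w) =
       (\<Sum>j<l. if shape (v(j := Suc (v j))) then f (v(j := Suc (v j))) else 0) +
       (\<Sum>j<l. if v j > 0 \<and> shape (v(j := v j - 1)) then f (v(j := v j - 1)) else 0) +
       (if stay v then f v else 0)"
proof -
  let ?U = "{w. shape w \<and> w l = 0 \<and> covers v w}" and ?D = "{w. shape w \<and> w l = 0 \<and> covers w v}"
    and ?V = "if stay v then {v} else {}"
  have eq: "nbrs stay l v = ?U \<union> ?D \<union> ?V" using assms by (auto simp: nbrs_def)
  have fin: "finite ?U" "finite ?D" "finite ?V" using up_nbrs[OF assms] down_nbrs[OF assms] by auto
  then show "finite (nbrs stay l v)" unfolding eq by blast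
  have disj: "?U \<inter> ?D = {}" "(?U \<union> ?D) \<inter> ?V = {}" using covers_asym covers_neq by auto
  have "inj_on (\<lambda>j. v(j := Suc (v j))) A" for A
    by (rule inj_onI) (metis fun_upd_apply n_not_Suc_n)
  then have U: "sum f ?U = (\<Sum>j<l. if shape (v(j := Suc (v j))) then f (v(j := Suc (v j))) else 0)"
    unfolding up_nbrs[OF assms] by (subst sum.reindex) (auto simp: sum.inter_filter[symmetric] lessThan_def)
  have "inj_on (\<lambda>j. v(j := v j - 1)) {j. j < l \<and> v j > 0 \<and> shape (v(j := v j - 1))}"
    by (rule inj_onI) (metis (no_types, lifting) One_nat_def diff_Suc_less fun_upd_apply less_irrefl mem_Collect_eq)
  then have D: "sum f ?D = (\<Sum>j<l. if v j > 0 \<and> shape (v(j := v j - 1)) then f (v(j := v j - 1)) else 0)"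
    unfolding down_nbrs[OF assms] by (subst sum.reindex) (auto simp: sum.inter_filter[symmetric] lessThan_def)
  have "sum f (nbrs stay l v) = sum f ?U + sum f ?D + sum f ?V"
    unfolding eq using fin disj by (subst sum.union_disjoint, blast, blast, blast, subst sum.union_disjoint) auto
  then show "(\<Sum>w\<in>nbrs stay l v. f w) =
       (\<Sum>j<l. if shape (v(j := Suc (v j))) then f (v(j := Suc (v j))) else 0) +
       (\<Sum>j<l. if v j > 0 \<and> shape (v(j := v j - 1)) then f (v(j := v j - 1)) else 0) +
       (if stay v then f v else 0)" by (simp add: U D)
qed

lemma walks_0: "walks stay l 0 v = (if v = (\<lambda>_. 0) then {\<lambda>_ _. 0} else {})"
  by (auto simp: walks_def)

text \<open>Decomposition by the first step: \<open>case_nat v\<close> puts \<open>v\<close> in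
  front of a walk.\<close>

lemma walks_Suc:
  "walks stay l (Suc n) v = (\<Union>w\<in>nbrs stay l v. case_nat v ` walks stay l n w)"
proof (intro equalityI subsetI)
  fix s assume s: "s \<in> walks stay l (Suc n) v"
  have "s = case_nat v (\<lambda>i. s (Suc i))" using s by (auto simp: walks_def fun_eq_iff split: nat.split)
  moreover have "(\<lambda>i. s (Suc i)) \<in> walks stay l n (s 1)" using s by (auto simp: walks_def)
  moreover have "s 1 \<in> nbrs stay l v" using s by (force simp: walks_def)
  ultimately show "s \<in> (\<Union>w\<in>nbrs stay l v. case_nat v ` walks stay l n w)" by blast
next
  fix s assume "s \<in> (\<Union>w\<in>nbrs stay l v. case_nat v ` walks stay l n w)"
  then obtain w s' where s': "w \<in> nbrs stay l v" "s' \<in> walks stay l n w" "s = case_nat v s'" by blast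
  then show "s \<in> walks stay l (Suc n) v"
    unfolding walks_def by (auto split: nat.split simp: Suc_le_eq less_Suc_eq_0_disj gr0_conv_Suc)
qed

lemma card_walks_Suc:
  assumes "shape v" "v l = 0"
  shows "finite (walks stay l n v)"
    and "card (walks stay l (Suc n) v) = (\<Sum>w\<in>nbrs stay l v. card (walks stay l n w))"
proof -
  have fin: "finite (walks stay l n v)" if "shape v" "v l = 0" for v n
    using that
  proof (induction n arbitrary: v)
    case (Suc n)
    then show ?case unfolding walks_Suc using sum_nbrs(1)[OF Suc.prems, of stay] by (auto simp: nbrs_def)
  qed (auto simp: walks_0)
  show "finite (walks stay l n v)" using fin assms by blast
  have inj: "inj_on (case_nat v) A" for A :: "(nat \<Rightarrow> nat \<Rightarrow> nat) set"
    by (rule inj_onI, rule ext) (metis old.nat.simps(5))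
  have "card (walks stay l (Suc n) v) = (\<Sum>w\<in>nbrs stay l v. card (case_nat v ` walks stay l n w))"
    unfolding walks_Suc
  proof (rule card_UN_disjoint)
    show "finite (nbrs stay l v)" using sum_nbrs(1)[OF assms] .
    show "\<forall>w\<in>nbrs stay l v. finite (case_nat v ` walks stay l n w)" using fin by (auto simp: nbrs_def)
    show "\<forall>w\<in>nbrs stay l v. \<forall>w'\<in>nbrs stay l v. w \<noteq> w' \<longrightarrow>
        case_nat v ` walks stay l n w \<inter> case_nat v ` walks stay l n w' = {}"
    proof (intro ballI impI)
      fix w w' :: "nat \<Rightarrow> nat" assume "w \<noteq> w'"
      then have "walks stay l n w \<inter> walks stay l n w' = {}" by (auto simp: walks_def)
      then show "case_nat v ` walks stay l n w \<inter> case_nat v ` walks stay l n w' = {}"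
        using inj[of UNIV] by (metis image_Int image_empty)
    qed
  qed
  then show "card (walks stay l (Suc n) v) = (\<Sum>w\<in>nbrs stay l v. card (walks stay l n w))"
    by (simp add: card_image[OF inj])
qed

text \<open>The differential equation gives \<open>fact n * fps_nth (Z v) n\<close> the same
  first-step recursion as the walk numbers.\<close>

lemma card_walks_eq_coeff:
  fixes Z :: "(nat \<Rightarrow> nat) \<Rightarrow> rat fps"
  assumes "\<And>v. shape v \<Longrightarrow> v l = 0 \<Longrightarrow> fps_deriv (Z v) = (\<Sum>w\<in>nbrs stay l v. Z w)"
    and "\<And>v. shape v \<Longrightarrow> v l = 0 \<Longrightarrow> fps_nth (Z v) 0 = (if v = (\<lambda>_. 0) then 1 else 0)"
    and "shape v" "v l = 0"
  shows "of_nat (card (walks stay l n v)) = fact n * fps_nth (Z v) n"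
  using assms(3,4)
proof (induction n arbitrary: v)
  case 0
  then show ?case using assms(2) by (simp add: walks_0)
next
  case (Suc n)
  have "of_nat (card (walks stay l (Suc n) v)) = (\<Sum>w\<in>nbrs stay l v. fact n * fps_nth (Z w) n)"
    using Suc by (auto simp: card_walks_Suc(2) nbrs_def intro!: sum.cong)
  also have "\<dots> = fact n * fps_nth (fps_deriv (Z v)) n"
    by (simp add: assms(1)[OF Suc.prems] fps_sum_nth sum_distrib_left)
  also have "\<dots> = fact (Suc n) * fps_nth (Z v) (Suc n)" by simp
  finally show ?case .
qed

section \<open>Determinants with rows indexed by walker positions\<close>

lemma fps_deriv_prod_sum:
  fixes f :: "'i \<Rightarrow> 'a :: comm_ring_1 fps"
  assumes "finite S"
  shows "fps_deriv (\<Prod>i\<in>S. f i) = (\<Sum>i\<in>S. \<Prod>k\<in>S. if k = i then fps_deriv (f k) else f k)"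
  using assms
proof (induction S)
  case (insert a S)
  have "(\<Sum>i\<in>S. \<Prod>k\<in>insert a S. if k = i then fps_deriv (f k) else f k) =
      (\<Sum>i\<in>S. f a * (\<Prod>k\<in>S. if k = i then fps_deriv (f k) else f k))"
    using insert by (intro sum.cong) auto
  moreover have "(\<Prod>k\<in>insert a S. if k = a then fps_deriv (f k) else f k) = fps_deriv (f a) * (\<Prod>k\<in>S. f k)"
    using insert by (auto intro!: prod.cong arg_cong2[of _ _ _ _ "(*)"])
  ultimately show ?case using insert by (simp add: sum_distrib_left add.commute)
qed simp

text \<open>Row \<open>i\<close> depends only on the position of walker \<open>i\<close>, so moving
  one walker changes one row; the columns belong to the fixed end positions.\<close>

definition row_det :: "(int \<Rightarrow> nat \<Rightarrow> 'a :: comm_ring_1) \<Rightarrow> nat \<Rightarrow> (nat \<Rightarrow> int) \<Rightarrow> 'a" where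
  "row_det F l x = det (mat l l (\<lambda>(i, j). F (x i) j))"

lemma row_det_altdef:
  "row_det F l x = (\<Sum>p | p permutes {0..<l}. signof p * (\<Prod>i = 0..<l. F (x i) (p i)))"
  unfolding row_det_def by (subst det_def') (auto intro!: sum.cong prod.cong simp: permutes_in_image)

lemma row_det_identical: "i < l \<Longrightarrow> j < l \<Longrightarrow> i \<noteq> j \<Longrightarrow> x i = x j \<Longrightarrow> row_det F l x = 0"
  unfolding row_det_def by (rule det_identical_rows[of _ l i j]) auto

lemma row_det_zero:
  assumes "i < l" "\<And>j. j < l \<Longrightarrow> F (x i) j = 0" shows "row_det F l x = 0"
  unfolding row_det_altdef
proof (intro sum.neutral ballI)
  fix p assume "p \<in> {p. p permutes {0..<l}}"
  then have "p i < l" using assms(1) permutes_in_image[of p "{0..<l}" i] by simp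
  then have "F (x i) (p i) = 0" using assms(2) by simp
  then have "(\<Prod>i = 0..<l. F (x i) (p i)) = 0" using assms(1) by (intro prod_zero bexI[of _ i]) auto
  then show "signof p * (\<Prod>i = 0..<l. F (x i) (p i)) = 0" by simp
qed

lemma row_det_cong: "(\<And>i. i < l \<Longrightarrow> x i = y i) \<Longrightarrow> row_det F l x = row_det F l y"
  unfolding row_det_altdef by (auto intro!: sum.cong prod.cong)

text \<open>The product rule differentiates one row at a time, and the assumption splits that row
  into the two neighbouring positions.\<close>

lemma row_det_deriv:
  fixes F :: "int \<Rightarrow> nat \<Rightarrow> 'a :: comm_ring_1 fps"
  assumes "\<And>k j. fps_deriv (F k j) = F (k + 1) j + F (k - 1) j"
  shows "fps_deriv (row_det F l x) = (\<Sum>i<l. row_det F l (x(i := x i + 1)) + row_det F l (x(i := x i - 1)))"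
proof -
  have split: "(\<Prod>k = 0..<l. if k = i then fps_deriv (F (x k) (p k)) else F (x k) (p k)) =
      (\<Prod>k = 0..<l. F ((x(i := x i + 1)) k) (p k)) + (\<Prod>k = 0..<l. F ((x(i := x i - 1)) k) (p k))"
    if "i < l" for i and p :: "nat \<Rightarrow> nat"
  proof -
    let ?r = "\<Prod>k \<in> {0..<l} - {i}. F (x k) (p k)"
    have i: "i \<in> {0..<l}" using that by simp
    have "(\<Prod>k = 0..<l. if k = i then fps_deriv (F (x k) (p k)) else F (x k) (p k)) = fps_deriv (F (x i) (p i)) * ?r"
      by (subst prod.remove[OF _ i]) (auto intro!: prod.cong arg_cong2[of _ _ _ _ "(*)"])
    moreover have "(\<Prod>k = 0..<l. F ((x(i := y)) k) (p k)) = F y (p i) * ?r" for y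
      by (subst prod.remove[OF _ i]) (auto intro!: prod.cong arg_cong2[of _ _ _ _ "(*)"])
    ultimately show ?thesis by (simp add: assms distrib_right)
  qed
  have split_sum: "(\<Sum>i = 0..<l. \<Prod>k = 0..<l. if k = i then fps_deriv (F (x k) (p k)) else F (x k) (p k)) =
      (\<Sum>i<l. (\<Prod>k = 0..<l. F ((x(i := x i + 1)) k) (p k)) + (\<Prod>k = 0..<l. F ((x(i := x i - 1)) k) (p k)))"
    for p :: "nat \<Rightarrow> nat"
    by (rule sum.cong) (use split in auto)
  have sgn: "fps_deriv (signof p * A) = signof p * fps_deriv A" for p :: "nat \<Rightarrow> nat" and A :: "'a fps"
    by (simp add: sign_def)
  have "fps_deriv (row_det F l x) = (\<Sum>p | p permutes {0..<l}. signof p *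
      (\<Sum>i<l. (\<Prod>k = 0..<l. F ((x(i := x i + 1)) k) (p k)) + (\<Prod>k = 0..<l. F ((x(i := x i - 1)) k) (p k))))"
    unfolding row_det_altdef fps_deriv_sum sgn fps_deriv_prod_sum[OF finite_atLeastLessThan] split_sum ..
  also have "\<dots> = (\<Sum>i<l. row_det F l (x(i := x i + 1)) + row_det F l (x(i := x i - 1)))"
    unfolding row_det_altdef sum.distrib[symmetric] sum_distrib_left
    by (subst sum.swap) (simp add: distrib_left)
  finally show ?thesis .
qed

text \<open>Taking the constant coefficient is a ring homomorphism, hence commutes with
  determinants.\<close>

lemma fps_nth_0_row_det: "fps_nth (row_det F l x) 0 = row_det (\<lambda>k j. fps_nth (F k j) 0) l x"
proof -
  have prod: "fps_nth (\<Prod>i\<in>S. f i) 0 = (\<Prod>i\<in>S. fps_nth (f i) 0)" for S and f :: "'b \<Rightarrow> 'a :: comm_ring_1 fps"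
    by (induction S rule: infinite_finite_induct) auto
  have sgn: "fps_nth (signof p * A) 0 = signof p * fps_nth A 0" for p :: "nat \<Rightarrow> nat" and A :: "'a fps"
    by (simp add: sign_def)
  show ?thesis unfolding row_det_altdef fps_sum_nth sgn prod ..
qed

text \<open>The columns of a shape as strictly increasing walkers on the positive integers,
  the shortest column first.\<close>
definition position :: "nat \<Rightarrow> (nat \<Rightarrow> nat) \<Rightarrow> nat \<Rightarrow> int" where
  "position l v i = int (v (l - Suc i)) + int i + 1"

text \<open>Only an equally high column to the left blocks a raise; in terms of
  \<open>position\<close>, the two walkers then collide.\<close>

lemma not_shape_upd_Suc:
  assumes "shape v" "\<not> shape (v(j := Suc (v j)))" shows "j > 0 \<and> v (j - 1) = v j"
proof (rule ccontr)
  assume *: "\<not> (j > 0 \<and> v (j - 1) = v j)"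
  have "v i > v j" if "i < j" for i
  proof -
    have "v (j - 1) \<le> v i" "v j \<le> v (j - 1)" using that shape_antimono[OF assms(1)] by auto
    then show ?thesis using * that by auto
  qed
  then have "cover_row (v j) v (v(j := Suc (v j)))" using assms(1) unfolding cover_row_def by blast
  then show False using cover_row_shape(2) assms(2) by blast
qed

lemma not_shape_upd_pred:
  assumes "shape v" "v j > 0" "\<not> shape (v(j := v j - 1))" shows "v (Suc j) = v j"
proof (rule ccontr)
  assume *: "v (Suc j) \<noteq> v j"
  let ?w = "v(j := v j - 1)"
  have "v (Suc j) \<le> v j" using shape_antimono[OF assms(1)] by simp
  then have less: "v (Suc j) \<le> v j - 1" using * by simp
  have "?w b \<le> ?w a" if "a \<le> b" for a b
  proof (cases "a = j \<and> b \<noteq> j")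
    case True
    then have "v b \<le> v (Suc j)" using that shape_antimono[OF assms(1)] by simp
    then show ?thesis using True less by simp
  next
    case False
    then show ?thesis using that shape_antimono[OF assms(1) that] by auto
  qed
  moreover obtain N where "v N = 0" using assms(1) by (auto simp: shape_def)
  then have "?w N = 0" using assms(2) by auto
  ultimately have "shape ?w" unfolding shape_def antimono_def by blast
  then show False using assms(3) by blast
qed

text \<open>Moves out of the chamber make two rows equal, except for the lowest walker stepping from
  1 to 0, which is left to the boundary condition of \<open>F\<close>.\<close>
lemma row_det_position_deriv:
  fixes F :: "int \<Rightarrow> nat \<Rightarrow> 'a :: comm_ring_1 fps"
  assumes F: "\<And>k j. fps_deriv (F k j) = F (k + 1) j + F (k - 1) j"
    and v: "shape v" "v l = 0"
  shows "fps_deriv (row_det F l (position l v)) =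
     (\<Sum>w\<in>nbrs (\<lambda>_. False) l v. row_det F l (position l w)) +
     (if l > 0 \<and> v (l - 1) = 0 then row_det F l ((position l v)(0 := 0)) else 0)"
proof -
  let ?x = "position l v" and ?E = "\<lambda>w. row_det F l (position l w)"
  let ?c = "if v (l - 1) = 0 then row_det F l (?x(0 := 0)) else 0"
  \<comment> \<open>Column \<open>j\<close> is walker \<open>l - Suc j\<close>, since walkers are
    listed from the shortest column.\<close>
  have upd: "row_det F l (?x(l - Suc j := ?x (l - Suc j) + int y - int (v j))) = ?E (v(j := y))" if "j < l" for j y
    using that by (intro row_det_cong) (auto simp: position_def)
  have up: "row_det F l (?x(l - Suc j := ?x (l - Suc j) + 1)) =
      (if shape (v(j := Suc (v j))) then ?E (v(j := Suc (v j))) else 0)" if j: "j < l" for j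
  proof (cases "shape (v(j := Suc (v j)))")
    case True
    then show ?thesis using upd[OF j, of "Suc (v j)"] by (simp add: algebra_simps)
  next
    case False
    then have "j > 0" "v (j - 1) = v j" using not_shape_upd_Suc[OF v(1)] by auto
    moreover from this have "l - Suc (Suc (l - Suc j)) = j - 1" "l - Suc (l - Suc j) = j" using j by auto
    ultimately have "row_det F l (?x(l - Suc j := ?x (l - Suc j) + 1)) = 0"
      using j by (intro row_det_identical[of "l - Suc j" l "Suc (l - Suc j)"]) (auto simp: position_def)
    then show ?thesis using False by simp
  qed
  have down: "row_det F l (?x(l - Suc j := ?x (l - Suc j) - 1)) =
      (if v j > 0 \<and> shape (v(j := v j - 1)) then ?E (v(j := v j - 1)) else 0) +
      (if j = l - 1 then ?c else 0)" if j: "j < l" for j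
  proof (cases "v j > 0 \<and> shape (v(j := v j - 1))")
    case True
    then show ?thesis using upd[OF j, of "v j - 1"] by (auto simp: algebra_simps of_nat_diff)
  next
    case False
    show ?thesis
    proof (cases "j = l - 1 \<and> v j = 0")
      case True
      then have eq: "?x(l - Suc j := ?x (l - Suc j) - 1) = ?x(0 := 0)" using j by (auto simp: position_def)
      have "v (l - 1) = 0" "(j = l - 1) = True" "v j = 0" using True by auto
      then show ?thesis unfolding eq by simp
    next
      case ne: False
      have eq: "v (Suc j) = v j"
      proof (cases "v j = 0")
        case True
        then show ?thesis using shape_antimono[OF v(1), of j "Suc j"] by simp
      next
        case pos: False
        then show ?thesis using False not_shape_upd_pred[OF v(1), of j] by auto
      qed
      \<comment> \<open>If \<open>Suc j = l\<close>, column \<open>j\<close> would be the last one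
        and empty, which is the wall case settled above.\<close>
      then have "Suc j < l" using ne v(2) j by (cases "Suc j = l") auto
      then have "row_det F l (?x(l - Suc j := ?x (l - Suc j) - 1)) = 0"
        using eq by (intro row_det_identical[of "l - Suc j" l "l - Suc (Suc j)"]) (auto simp: position_def)
      then show ?thesis using False ne by auto
    qed
  qed
  have "fps_deriv (?E v) = (\<Sum>j<l. row_det F l (?x(l - Suc j := ?x (l - Suc j) + 1)) + row_det F l (?x(l - Suc j := ?x (l - Suc j) - 1)))"
    \<comment> \<open>Reversing the index turns the sum over walkers into a sum over
      columns.\<close>
    unfolding row_det_deriv[of F, OF F] by (subst sum.nat_diff_reindex[symmetric]) simp
  also have "\<dots> = (\<Sum>j<l. (if shape (v(j := Suc (v j))) then ?E (v(j := Suc (v j))) else 0) +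
      ((if v j > 0 \<and> shape (v(j := v j - 1)) then ?E (v(j := v j - 1)) else 0) + (if j = l - 1 then ?c else 0)))"
    by (intro sum.cong refl) (simp only: up down lessThan_iff)
  also have "\<dots> = (\<Sum>w\<in>nbrs (\<lambda>_. False) l v. ?E w) + (\<Sum>j<l. if j = l - 1 then ?c else 0)"
    unfolding sum_nbrs(2)[OF v] by (simp add: sum.distrib)
  also have "(\<Sum>j<l. if j = l - 1 then ?c else 0) = (if l > 0 \<and> v (l - 1) = 0 then row_det F l (?x(0 := 0)) else 0)"
    by (subst sum.delta) auto
  finally show ?thesis .
qed

text \<open>The empty shape has positions 1 to \<open>l\<close> and gives the identity matrix.
  Otherwise the top walker is beyond \<open>l\<close>, and its row of constant terms
  vanishes.\<close>

lemma row_det_position_const: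
  fixes F :: "int \<Rightarrow> nat \<Rightarrow> 'a :: comm_ring_1 fps"
  assumes F: "\<And>k j. k > 0 \<Longrightarrow> fps_nth (F k j) 0 = (if k = int j + 1 then 1 else 0)"
    and v: "shape v" "v l = 0"
  shows "fps_nth (row_det F l (position l v)) 0 = (if v = (\<lambda>_. 0) then 1 else 0)"
proof (cases "v = (\<lambda>_. 0)")
  case True
  have "mat l l (\<lambda>(i, j). fps_nth (F (position l v i) j) 0) = 1\<^sub>m l"
    using True F by (intro eq_matI) (auto simp: position_def)
  then show ?thesis using True unfolding fps_nth_0_row_det by (simp add: row_det_def)
next
  case False
  then have "v 0 \<noteq> 0" using shape_antimono[OF v(1), of 0] by fastforce
  then have "l > 0" "v 0 > 0" using v(2) by (cases l; auto)+
  then have "row_det (\<lambda>k j. fps_nth (F k j) 0) l (position l v) = 0"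
    using F by (intro row_det_zero[of "l - 1"]) (auto simp: position_def)
  then show ?thesis using False by (simp add: fps_nth_0_row_det)
qed

section \<open>Coefficients, symmetry and derivative of the Bessel series\<close>

lemma bessel_fps_nth_sum:
  "fps_nth (bessel_fps i) k =
     (\<Sum>n | int n \<ge> max 0 (- i) \<and> 2 * int n + i = int k. 1 / (fact n * fact (nat (int n + i))))"
proof -
  let ?A = "{n. int n \<ge> max 0 (- i)}"
  let ?f = "\<lambda>n. fps_const (1 / (fact n * fact (nat (int n + i)))) * fps_X ^ nat (2 * int n + i) :: rat fps"
  have nth: "fps_nth (?f n) k = (if 2 * int n + i = int k then 1 / (fact n * fact (nat (int n + i))) else 0)"
    if "n \<in> ?A" for n
    using that by (auto simp: fps_X_power_nth)
  have "fps_nth (bessel_fps i) k = (\<Sum>n | n \<in> ?A \<and> fps_nth (?f n) k \<noteq> 0. fps_nth (?f n) k)"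
    by (rule has_sum_fpsD(2)[OF bessel_fps_has_sum])
  also have "\<dots> = (\<Sum>n | int n \<ge> max 0 (- i) \<and> 2 * int n + i = int k. 1 / (fact n * fact (nat (int n + i))))"
    using nth by (intro sum.cong) auto
  finally show ?thesis .
qed

text \<open>The substitution \<open>n = p\<close>, \<open>n + i = q\<close> makes the coefficients
  symmetric, so that negating the index just swaps \<open>p\<close> and \<open>q\<close>.\<close>

lemma bessel_fps_nth: "fps_nth (bessel_fps (int q - int p)) (p + q) = 1 / (fact p * fact q)"
proof -
  have "{n. int n \<ge> max 0 (- (int q - int p)) \<and> 2 * int n + (int q - int p) = int (p + q)} = {p}" by auto
  then show ?thesis unfolding bessel_fps_nth_sum by simp
qed

lemma bessel_fps_nth_eq_0:
  assumes "\<And>p q. i = int q - int p \<Longrightarrow> k \<noteq> p + q" shows "fps_nth (bessel_fps i) k = 0"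
proof -
  have "2 * int n + i \<noteq> int k" if "int n \<ge> max 0 (- i)" for n
    using assms[of "nat (int n + i)" n] that by auto
  then have empty: "{n. int n \<ge> max 0 (- i) \<and> 2 * int n + i = int k} = {}" by blast
  show ?thesis unfolding bessel_fps_nth_sum empty by simp
qed

lemma bessel_fps_minus: "bessel_fps (- i) = bessel_fps i"
proof (rule fps_ext)
  fix k
  show "fps_nth (bessel_fps (- i)) k = fps_nth (bessel_fps i) k"
  proof (cases "\<exists>p q. i = int q - int p \<and> k = p + q")
    case True
    then obtain p q where "i = int q - int p" "k = p + q" by blast
    then show ?thesis using bessel_fps_nth[of q p] bessel_fps_nth[of p q] by (simp add: add.commute mult.commute)
  next
    case False
    have "fps_nth (bessel_fps i) k = 0" using False by (intro bessel_fps_nth_eq_0) blast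
    moreover have "fps_nth (bessel_fps (- i)) k = 0"
    proof (rule bessel_fps_nth_eq_0)
      fix p q assume "- i = int q - int p"
      then have "i = int p - int q" by simp
      then show "k \<noteq> p + q" using False by (metis add.commute)
    qed
    ultimately show ?thesis by simp
  qed
qed

lemma bessel_fps_const: "fps_nth (bessel_fps i) 0 = (if i = 0 then 1 else 0)"
  using bessel_fps_nth[of 0 0] by (cases "i = 0") (auto intro!: bessel_fps_nth_eq_0)

text \<open>In terms of \<open>p\<close> and \<open>q\<close> the factor \<open>p + q\<close> from
  differentiation splits, and each summand cancels into one of the two factorials.\<close>

lemma bessel_fps_deriv: "fps_deriv (bessel_fps i) = bessel_fps (i + 1) + bessel_fps (i - 1)"
proof (rule fps_ext)
  fix k
  show "fps_nth (fps_deriv (bessel_fps i)) k = fps_nth (bessel_fps (i + 1) + bessel_fps (i - 1)) k"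
  proof (cases "\<exists>p q. i = int q - int p \<and> Suc k = p + q")
    case True
    then obtain p q where pq: "i = int q - int p" "Suc k = p + q" by blast
    have 1: "fps_nth (bessel_fps i) (Suc k) = 1 / (fact p * fact q)"
      using pq bessel_fps_nth by simp
    have 2: "fps_nth (bessel_fps (i + 1)) k = of_nat p / (fact p * fact q)"
    proof (cases p)
      \<comment> \<open>Here the index \<open>i + 1\<close> exceeds the exponent \<open>k\<close>,
        so the coefficient is 0, in agreement with the factor \<open>p\<close>.\<close>
      case 0
      then show ?thesis using pq by (subst bessel_fps_nth_eq_0) auto
    next
      case (Suc p')
      then have "i + 1 = int q - int p'" "k = p' + q" using pq by auto
      then show ?thesis using Suc bessel_fps_nth[of q p'] by (simp del: of_nat_Suc)
    qed
    have 3: "fps_nth (bessel_fps (i - 1)) k = of_nat q / (fact p * fact q)"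
    proof (cases q)
      case 0
      then show ?thesis using pq by (subst bessel_fps_nth_eq_0) auto
    next
      case (Suc q')
      then have "i - 1 = int q' - int p" "k = p + q'" using pq by auto
      then show ?thesis using Suc bessel_fps_nth[of q' p] by (simp del: of_nat_Suc)
    qed
    have "fps_nth (fps_deriv (bessel_fps i)) k = of_nat (p + q) / (fact p * fact q)"
      unfolding fps_deriv_nth using 1 pq(2) by simp
    then show ?thesis by (simp add: 2 3 add_divide_distrib)
  next
    case False
    have "fps_nth (bessel_fps i) (Suc k) = 0" using False by (intro bessel_fps_nth_eq_0) blast
    moreover have "fps_nth (bessel_fps (i + 1)) k = 0"
    proof (rule bessel_fps_nth_eq_0)
      fix p q assume "i + 1 = int q - int p"
      then have "i = int q - int (Suc p)" by simp
      then show "k \<noteq> p + q" using False by (metis add_Suc)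
    qed
    moreover have "fps_nth (bessel_fps (i - 1)) k = 0"
    proof (rule bessel_fps_nth_eq_0)
      fix p q assume "i - 1 = int q - int p"
      then have "i = int (Suc q) - int p" by simp
      then show "k \<noteq> p + q" using False by (metis add_Suc_right)
    qed
    ultimately show ?thesis by simp
  qed
qed

section \<open>Boundary conditions at the wall and the two generating functions\<close>

lemma row_det_walks_odd:
  assumes "shape v" "v l = 0"
  shows "of_nat (card (walks (\<lambda>_. True) l n v)) = fact n * fps_nth (fps_exp (1 :: rat) *
     row_det (\<lambda>k j. bessel_fps (k - int (j + 1)) - bessel_fps (k + int (j + 1))) l (position l v)) n"
proof (rule card_walks_eq_coeff[where Z = "\<lambda>v. fps_exp 1 * row_det (\<lambda>k j. bessel_fps (k - int (j + 1)) - bessel_fps (k + int (j + 1))) l (position l v)"])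
  let ?F = "\<lambda>k j. bessel_fps (k - int (j + 1)) - bessel_fps (k + int (j + 1))"
  let ?D = "\<lambda>v. row_det ?F l (position l v)"
  have F: "fps_deriv (?F k j) = ?F (k + 1) j + ?F (k - 1) j" for k j
    by (simp add: bessel_fps_deriv algebra_simps)
  \<comment> \<open>The entries are antisymmetric under reflection of \<open>k\<close> at 0, so the
    wall absorbs: a walker at 0 gives a zero row.\<close>
  have "?F 0 j = 0" for j using bessel_fps_minus[of "int (j + 1)"] by simp
  then have wall: "l > 0 \<Longrightarrow> row_det ?F l ((position l v)(0 := 0)) = 0" for v
    by (intro row_det_zero[of 0]) (simp_all only: fun_upd_same)
  fix v :: "nat \<Rightarrow> nat" assume v: "shape v" "v l = 0"
  have "fps_deriv (?D v) = (\<Sum>w\<in>nbrs (\<lambda>_. False) l v. ?D w)"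
    using row_det_position_deriv[of ?F, OF F v] wall by simp
  moreover have "(\<Sum>w\<in>nbrs (\<lambda>_. True) l v. ?D w) = (\<Sum>w\<in>nbrs (\<lambda>_. False) l v. ?D w) + ?D v"
    using sum_nbrs(2)[OF v, of ?D] by simp
  \<comment> \<open>Differentiating the exponential factor contributes the stays.\<close>
  ultimately show "fps_deriv (fps_exp 1 * ?D v) = (\<Sum>w\<in>nbrs (\<lambda>_. True) l v. fps_exp 1 * ?D w)"
    by (simp add: sum_distrib_left[symmetric] distrib_left)
  have "fps_nth (?F k j) 0 = (if k = int j + 1 then 1 else 0)" if "k > 0" for k j
    using that by (auto simp: bessel_fps_const)
  then show "fps_nth (fps_exp 1 * ?D v) 0 = (if v = (\<lambda>_. 0) then 1 else 0)"
    using row_det_position_const[of ?F, OF _ v] by simp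
qed (use assms in auto)

text \<open>The entries are symmetric under exchange of \<open>k\<close> and \<open>1 - k\<close>,
  so a move from 1 to 0 counts as staying at 1. The lowest walker is at 1 exactly when
  \<open>v (l - 1) = 0\<close>, which is the stay condition.\<close>

lemma row_det_walks_even:
  assumes "shape v" "v l = 0" "l > 0"
  shows "of_nat (card (walks (\<lambda>v. v (l - 1) = 0) l n v)) = fact n * fps_nth (
     row_det (\<lambda>k j. bessel_fps (k - int (j + 1)) + bessel_fps (k + int (j + 1) - 1)) l (position l v)) n"
proof (rule card_walks_eq_coeff[where Z = "\<lambda>v. row_det (\<lambda>k j. bessel_fps (k - int (j + 1)) + bessel_fps (k + int (j + 1) - 1)) l (position l v)"])
  let ?F = "\<lambda>k j. bessel_fps (k - int (j + 1)) + bessel_fps (k + int (j + 1) - 1)"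
  let ?D = "\<lambda>v. row_det ?F l (position l v)"
  have F: "fps_deriv (?F k j) = ?F (k + 1) j + ?F (k - 1) j" for k j
    by (simp add: bessel_fps_deriv algebra_simps)
  have "?F 0 j = ?F 1 j" for j
    using bessel_fps_minus[of "int j"] bessel_fps_minus[of "1 + int j"] by (simp add: algebra_simps)
  then have wall: "row_det ?F l (x(0 := 0)) = row_det ?F l (x(0 := 1))" for x
    unfolding row_det_altdef by (intro sum.cong arg_cong2[of _ _ _ _ "(*)"] prod.cong) auto
  fix v :: "nat \<Rightarrow> nat" assume v: "shape v" "v l = 0"
  have "row_det ?F l ((position l v)(0 := 0)) = ?D v" if "v (l - 1) = 0"
  proof -
    have "(position l v)(0 := 1) = position l v" using that by (auto simp: position_def fun_eq_iff)
    then show ?thesis unfolding wall by simp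
  qed
  then show "fps_deriv (?D v) = (\<Sum>w\<in>nbrs (\<lambda>v. v (l - 1) = 0) l v. ?D w)"
    using row_det_position_deriv[of ?F, OF F v] sum_nbrs(2)[OF v, of ?D] assms(3) by simp
  have "fps_nth (?F k j) 0 = (if k = int j + 1 then 1 else 0)" if "k > 0" for k j
    using that by (auto simp: bessel_fps_const)
  then show "fps_nth (?D v) 0 = (if v = (\<lambda>_. 0) then 1 else 0)"
    using row_det_position_const[of ?F, OF _ v] by simp
qed (use assms in auto)

text \<open>Only the finitely many involutions of length \<open>n\<close> contribute to coefficient
  \<open>n\<close>, so the sum converges and can be compared coefficientwise.\<close>

lemma involutions_avoiding_has_sum:
  assumes "\<And>n. of_nat (card {\<tau>. involution n \<tau> \<and> \<not> has_descending_subsequence (m + 1) (n, \<tau>)}) = fact n * fps_nth S n"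
  shows "((\<lambda>(n, \<tau>). fps_const (1 / fact n) * fps_X ^ n) has_sum (S :: rat fps)) (involutions_avoiding m)"
proof (rule has_sum_fpsI)
  let ?f = "\<lambda>(n, \<tau> :: nat \<Rightarrow> nat). fps_const (1 / fact n) * fps_X ^ n :: rat fps"
  fix n
  let ?T = "{\<tau>. involution n \<tau> \<and> \<not> has_descending_subsequence (m + 1) (n, \<tau>)}"
  have eq: "{x \<in> involutions_avoiding m. fps_nth (?f x) n \<noteq> 0} = Pair n ` ?T"
    by (auto simp: involutions_avoiding_def involutions_def involution_def fps_X_power_nth split: if_splits)
  have "finite ?T" by (rule finite_subset[OF _ finite_permutations[of "{1..n}"]]) (auto simp: involution_def)
  then show "finite {x \<in> involutions_avoiding m. fps_nth (?f x) n \<noteq> 0}" unfolding eq by simp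
  have "(\<Sum>x | x \<in> involutions_avoiding m \<and> fps_nth (?f x) n \<noteq> 0. fps_nth (?f x) n) = of_nat (card ?T) / fact n"
    unfolding eq by (subst sum.reindex) (auto simp: inj_on_def fps_X_power_nth)
  also have "\<dots> = fps_nth S n" unfolding assms by simp
  finally show "fps_nth S n = (\<Sum>x | x \<in> involutions_avoiding m \<and> fps_nth (?f x) n \<noteq> 0. fps_nth (?f x) n)" by simp
qed

lemma position_zero: "position l (\<lambda>_. 0) = (\<lambda>i. int (i + 1))"
  by (simp add: position_def fun_eq_iff)

theorem theorem2:
  fixes m l :: nat
  assumes "m \<ge> 1"
  shows
    "(m = 2 * l + 1 \<longrightarrow>
       ((\<lambda>(n, \<tau>). fps_const (1 / fact n) * fps_X ^ n) has_sum
          fps_exp (1 :: rat) *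
          det (mat l l (\<lambda>(i, j). bessel_fps (int (i + 1) - int (j + 1))
                                - bessel_fps (int (i + 1) + int (j + 1)))))
         (involutions_avoiding m)) \<and>
     (m = 2 * l \<longrightarrow>
       ((\<lambda>(n, \<tau>). fps_const (1 / fact n) * fps_X ^ n) has_sum
          det (mat l l (\<lambda>(i, j). bessel_fps (int (i + 1) - int (j + 1))
                                + bessel_fps (int (i + 1) + int (j + 1) - 1))))
         (involutions_avoiding m))"
proof (intro conjI impI)
  assume "m = 2 * l + 1"
  then have "m + 1 = 2 * l + 2" by simp
  then show "((\<lambda>(n, \<tau>). fps_const (1 / fact n) * fps_X ^ n) has_sum
          fps_exp (1 :: rat) *
          det (mat l l (\<lambda>(i, j). bessel_fps (int (i + 1) - int (j + 1))
                                - bessel_fps (int (i + 1) + int (j + 1)))))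
         (involutions_avoiding m)"
    using row_det_walks_odd[of "\<lambda>_. 0" l] unfolding position_zero row_det_def
    by (intro involutions_avoiding_has_sum) (simp only: card_no_descending_odd shape_zero)
next
  assume "m = 2 * l"
  \<comment> \<open>The bound on \<open>m\<close> enters here: it gives \<open>l > 0\<close>, so
    that \<open>l - 1\<close> is a genuine column.\<close>
  then have "m + 1 = 2 * l + 1" "l > 0" using assms by auto
  then show "((\<lambda>(n, \<tau>). fps_const (1 / fact n) * fps_X ^ n) has_sum
          det (mat l l (\<lambda>(i, j). bessel_fps (int (i + 1) - int (j + 1))
                                + bessel_fps (int (i + 1) + int (j + 1) - 1))))
         (involutions_avoiding m)"
    using row_det_walks_even[of "\<lambda>_. 0" l] unfolding position_zero row_det_def
    by (intro involutions_avoiding_has_sum) (simp only: card_no_descending_even shape_zero)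
qed

end
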